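(* Let $X$ be an infinite compact metrizable space and $h\colon X\to X$ a minimal homeomorphism. If $(X,h)$ has the topological small boundary property, then $(X,h)$ has the dynamic comparison property.
   Context: $M_h(X)$ denotes the set of $h$-invariant Borel probability measures on $X$. A Borel set $E\subset X$ is universally null if $\mu(E)=0$ for all $\mu\in M_h(X)$. $\partial A$ denotes the topological boundary of $A\subset X$. A closed set $F\subset X$ is topologically $h$-small if there is $m\in\mathbb{Z}_{+}$ such that whenever $d(0),\dots,d(m)$ are $m+1$ distinct integers, $h^{d(0)}(F)\cap\cdots\cap h^{d(m)}(F)=\varnothing$. $(X,h)$ has the topological small boundary property if whenever $F,K\subset X$ are disjoint compact sets, there exist open sets $U,V\subset X$ with $F\subset U$, $K\subset V$, $\overline{U}\cap\overline{V}=\varnothing$ and $\partial U$ topologically $h$-small. $(X,h)$ has the dynamic comparison property if whenever $U\subset X$ is open and $C\subset X$ is closed with $\partial C,\partial U$ universally null and $\mu(C)<\mu(U)$ for every $\mu\in M_h(X)$, there exist $M\in\mathbb{N}$, continuous functions $f_j\colon X\to[0,1]$ ($0\le j\le M$) and integers $d(0),\dots,d(M)$ such that $\sum_{j=0}^M f_j=1$ on $C$ and the sets $\mathrm{supp}(f_j\circ h^{-d(j)})$, $0\le j\le M$, are pairwise disjoint subsets of $U$. *)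

theory Defs
  imports "HOL-Analysis.Analysis" "HOL-Probability.Probability"
begin

definition hpow :: "('a \<Rightarrow> 'a) \<Rightarrow> int \<Rightarrow> 'a \<Rightarrow> 'a" where
  "hpow h d = (if d \<ge> 0 then h ^^ nat d else (inv h) ^^ nat (- d))"

definition minimal_hom :: "('a::topological_space \<Rightarrow> 'a) \<Rightarrow> bool" where
  "minimal_hom h \<longleftrightarrow> (\<forall>Y. closed Y \<and> Y \<noteq> {} \<and> h ` Y = Y \<longrightarrow> Y = UNIV)"

definition inv_measures :: "('a::topological_space \<Rightarrow> 'a) \<Rightarrow> 'a measure set" where
  "inv_measures h = {\<mu>. sets \<mu> = sets borel \<and> prob_space \<mu> \<and>
       (\<forall>A\<in>sets borel. emeasure \<mu> (h -` A) = emeasure \<mu> A)}"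

definition universally_null :: "('a::topological_space \<Rightarrow> 'a) \<Rightarrow> 'a set \<Rightarrow> bool" where
  "universally_null h E \<longleftrightarrow> E \<in> sets borel \<and> (\<forall>\<mu>\<in>inv_measures h. emeasure \<mu> E = 0)"

definition top_small :: "('a::topological_space \<Rightarrow> 'a) \<Rightarrow> 'a set \<Rightarrow> bool" where
  "top_small h F \<longleftrightarrow> closed F \<and>
     (\<exists>m::nat. m > 0 \<and> (\<forall>d::nat \<Rightarrow> int. inj_on d {0..m} \<longrightarrow>
        (\<Inter>j\<in>{0..m}. hpow h (d j) ` F) = {}))"

definition top_small_boundary_property :: "('a::topological_space \<Rightarrow> 'a) \<Rightarrow> bool" where
  "top_small_boundary_property h \<longleftrightarrow>
     (\<forall>F K. compact F \<and> compact K \<and> F \<inter> K = {} \<longrightarrow>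
        (\<exists>U V. open U \<and> open V \<and> F \<subseteq> U \<and> K \<subseteq> V \<and>
               closure U \<inter> closure V = {} \<and> top_small h (frontier U)))"

definition supp_fun :: "('a::topological_space \<Rightarrow> real) \<Rightarrow> 'a set" where
  "supp_fun f = closure {x. f x \<noteq> 0}"

definition dynamic_comparison_property :: "('a::topological_space \<Rightarrow> 'a) \<Rightarrow> bool" where
  "dynamic_comparison_property h \<longleftrightarrow>
     (\<forall>U C. open U \<and> closed C \<and> universally_null h (frontier C) \<and>
            universally_null h (frontier U) \<and>
            (\<forall>\<mu>\<in>inv_measures h. emeasure \<mu> C < emeasure \<mu> U) \<longrightarrow>
        (\<exists>(M::nat) (f::nat \<Rightarrow> 'a \<Rightarrow> real) (d::nat \<Rightarrow> int).
            (\<forall>j\<le>M. continuous_on UNIV (f j) \<and> (\<forall>x. 0 \<le> f j x \<and> f j x \<le> 1)) \<and>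
            (\<forall>x\<in>C. (\<Sum>j\<le>M. f j x) = 1) \<and>
            (\<forall>j\<le>M. supp_fun (f j \<circ> hpow h (- d j)) \<subseteq> U) \<and>
            (\<forall>j\<le>M. \<forall>k\<le>M. j \<noteq> k \<longrightarrow>
               supp_fun (f j \<circ> hpow h (- d j)) \<inter> supp_fun (f k \<circ> hpow h (- d k)) = {})))"

end

theory Submission
  imports Defs
begin

text \<open>
  If \<open>\<mu>(C) < \<mu>(U)\<close> for all invariant \<open>\<mu>\<close>, then a Krylov--Bogoliubov argument gives a neighbourhood
  \<open>A\<close> of \<open>C\<close> and a set \<open>B\<close> with closure in \<open>U\<close> such that every sufficiently long orbit segment visits
  \<open>B\<close> at least as often as \<open>A\<close>; both can be chosen with topologically small boundary.  Cutting the orbits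
  at the visits to a small open set \<open>Y\<close> with long return times and small boundary, one matches the
  points of \<open>A\<close> injectively with points of \<open>B\<close> block by block.  The matching depends on a bounded part of
  the itinerary, so it moves finitely many pieces of \<open>A\<close> by fixed powers of \<open>h\<close>, and the boundaries of
  these pieces lie in a topologically small closed set \<open>F\<close>.  A neighbourhood of \<open>F\<close> is moved
  separately into a nonempty open part of \<open>U\<close> kept away from \<open>B\<close>.
\<close>

subsection \<open>Topological preliminaries\<close>

lemma closed_subset_open_closure:
  fixes K G :: "'a::t4_space set"
  assumes "closed K" "open G" "K \<subseteq> G"
  obtains W where "open W" "K \<subseteq> W" "closure W \<subseteq> G"
proof -
  have "\<exists>W V. open W \<and> open V \<and> K \<subseteq> W \<and> - G \<subseteq> V \<and> W \<inter> V = {}"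
    using assms by (intro t4_space) auto
  then obtain W V where WV: "open W" "open V" "K \<subseteq> W" "- G \<subseteq> V" "W \<inter> V = {}"
    by blast
  then have "closure W \<subseteq> - V"
    by (intro closure_minimal) auto
  then show ?thesis
    using that[OF WV(1,3)] WV(4) by blast
qed

lemma finite_disjoint_closed_neighbourhoods:
  fixes K :: "'i \<Rightarrow> 'a::t4_space set"
  assumes "finite I" "\<And>i. i \<in> I \<Longrightarrow> closed (K i)" "\<And>i. i \<in> I \<Longrightarrow> K i \<subseteq> V"
    "disjoint_family_on K I" "open V"
  shows "\<exists>N. (\<forall>i\<in>I. open (N i) \<and> K i \<subseteq> N i \<and> closure (N i) \<subseteq> V) \<and>
    disjoint_family_on (\<lambda>i. closure (N i)) I"
  using assms
proof (induction I arbitrary: V rule: finite_induct)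
  case empty
  show ?case by (simp add: disjoint_family_on_def)
next
  case (insert i I)
  have disj: "K i \<inter> K j = {}" if "j \<in> I" for j
    using disjoint_family_onD[OF insert.prems(3), of i j] that insert.hyps(2) by auto
  have "\<exists>N. (\<forall>j\<in>I. open (N j) \<and> K j \<subseteq> N j \<and> closure (N j) \<subseteq> V - K i) \<and>
    disjoint_family_on (\<lambda>j. closure (N j)) I"
  proof (rule insert.IH)
    show "K j \<subseteq> V - K i" if "j \<in> I" for j
      using insert.prems(2)[of j] disj[OF that] that by blast
    show "open (V - K i)" using insert.prems(1,4) by auto
  qed (use insert.prems(1,3) in \<open>auto intro: disjoint_family_on_mono\<close>)
  then obtain N where N: "\<And>j. j \<in> I \<Longrightarrow> open (N j)" "\<And>j. j \<in> I \<Longrightarrow> K j \<subseteq> N j"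
    "\<And>j. j \<in> I \<Longrightarrow> closure (N j) \<subseteq> V - K i" "disjoint_family_on (\<lambda>j. closure (N j)) I"
    by blast
  have "open (V - (\<Union>j\<in>I. closure (N j)))"
    using insert.hyps(1) insert.prems(4) by (intro open_Diff closed_UN) auto
  moreover have "K i \<subseteq> V - (\<Union>j\<in>I. closure (N j))"
    using N(3) insert.prems(2)[of i] by blast
  ultimately obtain P where P: "open P" "K i \<subseteq> P" "closure P \<subseteq> V - (\<Union>j\<in>I. closure (N j))"
    using closed_subset_open_closure insert.prems(1) by (metis insertI1)
  show ?case
  proof (intro exI[of _ "N(i := P)"] conjI ballI)
    show "open ((N(i := P)) j)" "K j \<subseteq> (N(i := P)) j" "closure ((N(i := P)) j) \<subseteq> V"
      if "j \<in> insert i I" for j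
      using that N(1-3)[of j] P by (auto split: if_splits)
    have "closure P \<inter> closure (N j) = {}" if "j \<in> I" for j
      using P(3) that by blast
    then show "disjoint_family_on (\<lambda>j. closure ((N(i := P)) j)) (insert i I)"
      using N(4) insert.hyps(2) unfolding disjoint_family_on_def by (auto simp: Int_commute)
  qed
qed

lemma compact_cover_by_compact_subsets:
  fixes K :: "'a::metric_space set"
  assumes "compact K" "\<And>i. i \<in> I \<Longrightarrow> open (G i)" "K \<subseteq> (\<Union>i\<in>I. G i)"
  obtains J L where "finite J" "J \<subseteq> I" "\<And>i. compact (L i)" "\<And>i. L i \<subseteq> G i"
    "\<And>i. i \<notin> J \<Longrightarrow> L i = {}" "K = (\<Union>i\<in>J. L i)"
proof -
  have "\<exists>i r. i \<in> I \<and> 0 < r \<and> cball x r \<subseteq> G i" if "x \<in> K" for x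
    using assms(2,3) that open_contains_cball by blast
  then obtain i r where ir: "\<And>x. x \<in> K \<Longrightarrow> i x \<in> I" "\<And>x. x \<in> K \<Longrightarrow> 0 < r x"
    "\<And>x. x \<in> K \<Longrightarrow> cball x (r x) \<subseteq> G (i x)"
    by metis
  have "K \<subseteq> (\<Union>x\<in>K. ball x (r x))" using ir(2) by force
  then obtain P where P: "P \<subseteq> K" "finite P" "K \<subseteq> (\<Union>x\<in>P. ball x (r x))"
    using compactE_image[OF assms(1), of K "\<lambda>x. ball x (r x)"] by blast
  define L where "L j = K \<inter> (\<Union>x\<in>{x \<in> P. i x = j}. cball x (r x))" for j
  show ?thesis
  proof (rule that[of "i ` P" L])
    show "compact (L j)" for j
      unfolding L_def using P(2) by (intro compact_Int_closed[OF assms(1)] closed_UN) auto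
    show "L j \<subseteq> G j" for j using ir(3) P(1) unfolding L_def by blast
    show "K = (\<Union>j\<in>i ` P. L j)" using P(3) by (force simp: L_def)
  qed (use P ir(1) in \<open>auto simp: L_def\<close>)
qed

lemma partition_of_unity_on_closed_family:
  fixes K W :: "'i \<Rightarrow> 'a::metric_space set"
  assumes "finite I" "\<And>i. closed (K i)" "\<And>i. open (W i)" "\<And>i. K i \<subseteq> W i"
  obtains f :: "'i \<Rightarrow> 'a \<Rightarrow> real" where "\<And>i. continuous_on UNIV (f i)"
    "\<And>i x. i \<in> I \<Longrightarrow> f i x \<in> {0..1}" "\<And>i x. x \<notin> W i \<Longrightarrow> f i x = 0"
    "\<And>x. x \<in> (\<Union>i\<in>I. K i) \<Longrightarrow> (\<Sum>i\<in>I. f i x) = 1"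
proof -
  have normal: "normal_space (euclidean :: 'a topology)"
    by (simp add: metrizable_imp_normal_space metrizable_space_euclidean)
  have "\<exists>g. continuous_map euclidean (top_of_set {0..1::real}) g \<and> g ` (- W i) \<subseteq> {0} \<and> g ` K i \<subseteq> {1}"
    for i
    by (rule Urysohn_lemma[OF normal, of "- W i" "K i" 0 1])
      (use assms(2-4)[of i] in \<open>auto simp: disjnt_iff\<close>)
  then obtain g :: "'i \<Rightarrow> 'a \<Rightarrow> real" where
    g: "\<And>i. continuous_map euclidean (top_of_set {0..1::real}) (g i)"
      "\<And>i. g i ` (- W i) \<subseteq> {0}" "\<And>i. g i ` K i \<subseteq> {1}"
    by metis
  then have g_cont: "continuous_on UNIV (g i)" and g01: "g i x \<in> {0..1}" for i x
    by (auto simp: continuous_map_in_subtopology Pi_iff)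
  define s where "s x = (\<Sum>i\<in>I. g i x)" for x
  define f where "f i x = g i x / max 1 (s x)" for i x
  have g_le_s: "g i x \<le> s x" if "i \<in> I" for i x
    unfolding s_def using assms(1) g01 that by (intro member_le_sum) auto
  show ?thesis
  proof (rule that[of f])
    show "continuous_on UNIV (f i)" for i
      unfolding f_def s_def by (intro continuous_intros g_cont) auto
    show "f i x \<in> {0..1}" if "i \<in> I" for i x
      using g01[of i x] g_le_s[OF that, of x] by (auto simp: f_def divide_le_eq)
    show "f i x = 0" if "x \<notin> W i" for i x
      using g(2)[of i] that by (auto simp: f_def)
    show "(\<Sum>i\<in>I. f i x) = 1" if x: "x \<in> (\<Union>i\<in>I. K i)" for x
    proof -
      obtain i where "i \<in> I" "x \<in> K i" using x by blast
      then have "1 \<le> s x" using g(3)[of i] g_le_s[of i x] by force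
      then show ?thesis unfolding f_def by (simp add: s_def flip: sum_divide_distrib)
    qed
  qed
qed

lemma notin_frontier_iff: "x \<notin> frontier S \<longleftrightarrow> (\<forall>\<^sub>F y in nhds x. y \<in> S \<longleftrightarrow> x \<in> S)"
proof -
  have interior: "x \<in> interior A \<longleftrightarrow> (\<forall>\<^sub>F y in nhds x. y \<in> A)" for A
    unfolding interior_def eventually_nhds by blast
  have "x \<notin> frontier S \<longleftrightarrow> x \<in> interior S \<or> x \<in> interior (- S)"
    by (auto simp: frontier_interiors)
  also have "\<dots> \<longleftrightarrow> (\<forall>\<^sub>F y in nhds x. y \<in> S \<longleftrightarrow> x \<in> S)"
    using interior_subset[of S] interior_subset[of "- S"] interior[of S] interior[of "- S"]
    by (cases "x \<in> S") auto
  finally show ?thesis .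
qed

lemma frontier_subset_of_local:
  fixes f :: "'i \<Rightarrow> 'a::t2_space \<Rightarrow> 'b::topological_space"
  assumes "finite I" "finite \<S>" "\<And>i. i \<in> I \<Longrightarrow> continuous_on UNIV (f i)"
    and local: "\<And>x y. (\<And>i S. i \<in> I \<Longrightarrow> S \<in> \<S> \<Longrightarrow> f i x \<in> S \<longleftrightarrow> f i y \<in> S) \<Longrightarrow> x \<in> E \<Longrightarrow> y \<in> E"
  shows "frontier E \<subseteq> (\<Union>i\<in>I. \<Union>S\<in>\<S>. f i -` frontier S)"
proof
  fix x assume x: "x \<in> frontier E"
  show "x \<in> (\<Union>i\<in>I. \<Union>S\<in>\<S>. f i -` frontier S)"
  proof (rule ccontr)
    assume away: "\<not> ?thesis"
    have "\<forall>\<^sub>F y in nhds x. f i y \<in> S \<longleftrightarrow> f i x \<in> S" if "i \<in> I" "S \<in> \<S>" for i S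
    proof -
      have "\<forall>\<^sub>F z in nhds (f i x). z \<in> S \<longleftrightarrow> f i x \<in> S"
        using away that notin_frontier_iff[of "f i x" S] by blast
      moreover have "filterlim (f i) (nhds (f i x)) (nhds x)"
        using assms(3)[OF that(1)]
        by (simp add: continuous_on_eq_continuous_at tendsto_at_iff_tendsto_nhds isCont_def)
      ultimately show ?thesis by (rule eventually_compose_filterlim)
    qed
    then have "\<forall>\<^sub>F y in nhds x. \<forall>i\<in>I. \<forall>S\<in>\<S>. f i y \<in> S \<longleftrightarrow> f i x \<in> S"
      using assms(1,2) by (simp add: eventually_ball_finite)
    then have "\<forall>\<^sub>F y in nhds x. y \<in> E \<longleftrightarrow> x \<in> E"
      by eventually_elim (use local in blast)
    then show False using x notin_frontier_iff by blast
  qed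
qed

lemma ex_filter_of_directed_family:
  assumes "I \<noteq> {}" "\<And>i. i \<in> I \<Longrightarrow> S i \<noteq> {}"
    and directed: "\<And>i j. i \<in> I \<Longrightarrow> j \<in> I \<Longrightarrow> \<exists>k\<in>I. S k \<subseteq> S i \<inter> S j"
  shows "\<exists>F. F \<noteq> bot \<and> (\<forall>i\<in>I. \<forall>\<^sub>F p in F. p \<in> S i)"
proof (intro exI conjI ballI)
  show "(INF i\<in>I. principal (S i)) \<noteq> bot"
    unfolding trivial_limit_def
  proof (subst eventually_INF_base)
    show "\<exists>k\<in>I. principal (S k) \<le> inf (principal (S i)) (principal (S j))"
      if "i \<in> I" "j \<in> I" for i j
      using directed[OF that] by simp
  qed (use assms(1,2) in \<open>auto simp: eventually_principal\<close>)
  show "\<forall>\<^sub>F p in INF i\<in>I. principal (S i). p \<in> S i" if "i \<in> I" for i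
    using that by (rule eventually_INF1) (simp add: eventually_principal)
qed

lemma ex_cluster_function:
  fixes \<nu> :: "'i \<Rightarrow> 'b \<Rightarrow> real"
  assumes "F \<noteq> bot" "\<And>i E. \<nu> i E \<in> {0..1}"
  shows "\<exists>\<psi>. \<forall>S. closed S \<longrightarrow> (\<forall>\<^sub>F i in F. \<nu> i \<in> S) \<longrightarrow> \<psi> \<in> S"
proof -
  have "compactin (product_topology (\<lambda>_. euclidean) UNIV) (PiE UNIV (\<lambda>_ :: 'b. {0..1 :: real}))"
    unfolding compactin_PiE by simp
  then have "compact (PiE UNIV (\<lambda>_ :: 'b. {0..1 :: real}))"
    by (simp add: euclidean_product_topology)
  moreover have "filtermap \<nu> F \<noteq> bot" using assms(1) by (simp add: filtermap_bot_iff)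
  moreover have "\<forall>\<^sub>F f in filtermap \<nu> F. f \<in> PiE UNIV (\<lambda>_. {0..1})"
    using assms(2) by (simp add: eventually_filtermap PiE_iff)
  ultimately obtain \<psi> where \<psi>: "inf (nhds \<psi>) (filtermap \<nu> F) \<noteq> bot"
    unfolding compact_filter by blast
  show ?thesis
  proof (intro exI[of _ \<psi>] allI impI, rule ccontr)
    fix S assume S: "closed S" "\<forall>\<^sub>F i in F. \<nu> i \<in> S" "\<psi> \<notin> S"
    have "\<forall>\<^sub>F f in nhds \<psi>. f \<in> - S"
      using S by (intro eventually_nhds_in_open) auto
    moreover have "\<forall>\<^sub>F f in filtermap \<nu> F. f \<in> S"
      using S(2) by (simp add: eventually_filtermap)
    ultimately have "\<forall>\<^sub>F f in inf (nhds \<psi>) (filtermap \<nu> F). False"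
      unfolding eventually_inf by fastforce
    then show False using \<psi> by (simp add: trivial_limit_def)
  qed
qed

subsection \<open>Regularisation of a finitely additive probability\<close>

locale probability_charge =
  fixes \<phi> :: "'a::metric_space set \<Rightarrow> ennreal"
  assumes positive: "positive (Pow UNIV) \<phi>"
    and additive: "additive (Pow UNIV) \<phi>"
    and total: "\<phi> UNIV = 1"
begin

sublocale sigma_algebra UNIV "Pow UNIV :: 'a set set"
  by (rule sigma_algebra_Pow)

lemma charge_mono: "A \<subseteq> B \<Longrightarrow> \<phi> A \<le> \<phi> B"
  using additive_increasing[OF positive additive] by (simp add: increasing_def)

definition inner_content :: "'a set \<Rightarrow> ennreal" where
  "inner_content G = (SUP K\<in>{K. compact K \<and> K \<subseteq> G}. \<phi> K)"

definition outer_content :: "'a set \<Rightarrow> ennreal" where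
  "outer_content A = (INF G\<in>{G. open G \<and> A \<subseteq> G}. inner_content G)"

lemma charge_le_inner_content: "compact K \<Longrightarrow> K \<subseteq> G \<Longrightarrow> \<phi> K \<le> inner_content G"
  unfolding inner_content_def by (rule SUP_upper) simp

lemma inner_content_leI:
  assumes "\<And>K. compact K \<Longrightarrow> K \<subseteq> G \<Longrightarrow> \<phi> K \<le> c"
  shows "inner_content G \<le> c"
  unfolding inner_content_def using assms by (intro SUP_least) auto

lemma inner_content_mono: "G \<subseteq> H \<Longrightarrow> inner_content G \<le> inner_content H"
  by (intro inner_content_leI charge_le_inner_content) auto

lemma inner_content_le_1: "inner_content G \<le> 1"
  using charge_mono[of _ UNIV] total by (intro inner_content_leI) auto

lemma outer_content_le_inner: "open G \<Longrightarrow> A \<subseteq> G \<Longrightarrow> outer_content A \<le> inner_content G"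
  unfolding outer_content_def by (rule INF_lower) simp

lemma outer_content_geI:
  assumes "\<And>G. open G \<Longrightarrow> A \<subseteq> G \<Longrightarrow> c \<le> inner_content G"
  shows "c \<le> outer_content A"
  unfolding outer_content_def using assms by (intro INF_greatest) auto

lemma outer_content_mono: "A \<subseteq> B \<Longrightarrow> outer_content A \<le> outer_content B"
  by (intro outer_content_geI outer_content_le_inner) auto

lemma outer_content_open: "open G \<Longrightarrow> outer_content G = inner_content G"
  by (intro antisym outer_content_le_inner outer_content_geI inner_content_mono) auto

lemma inner_content_UN_le:
  fixes G :: "nat \<Rightarrow> 'a set"
  assumes "\<And>i. open (G i)"
  shows "inner_content (\<Union>i. G i) \<le> (\<Sum>i. inner_content (G i))"
proof (rule inner_content_leI)
  fix K assume "compact K" "K \<subseteq> (\<Union>i. G i)"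
  then obtain J L where L: "finite J" "\<And>i. compact (L i)" "\<And>i. L i \<subseteq> G i" "K = (\<Union>i\<in>J. L i)"
    using compact_cover_by_compact_subsets[of K UNIV G] assms by metis
  have "\<phi> K \<le> (\<Sum>i\<in>J. \<phi> (L i))"
    unfolding L(4) using L(1) by (intro subadditive positive additive) auto
  also have "\<dots> \<le> (\<Sum>i\<in>J. inner_content (G i))"
    by (intro sum_mono charge_le_inner_content L(2,3))
  also have "\<dots> \<le> (\<Sum>i. inner_content (G i))"
    using L(1) by (intro sum_le_suminf) auto
  finally show "\<phi> K \<le> (\<Sum>i. inner_content (G i))" .
qed

lemma outer_content_approx:
  fixes \<epsilon> :: real
  assumes "0 < \<epsilon>"
  obtains G where "open G" "A \<subseteq> G" "inner_content G \<le> outer_content A + \<epsilon>"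
proof -
  have "outer_content A \<le> 1"
    using outer_content_le_inner[of UNIV A] inner_content_le_1[of UNIV] by auto
  then have "outer_content A \<noteq> top" by (auto simp: top_unique)
  then have "outer_content A < outer_content A + \<epsilon>"
    using assms by (auto simp: less_top)
  then obtain G where "open G" "A \<subseteq> G" "inner_content G < outer_content A + \<epsilon>"
    unfolding outer_content_def[of A] INF_less_iff by blast
  then show ?thesis using that by (simp add: less_imp_le)
qed

lemma outer_content_UN_le:
  fixes A :: "nat \<Rightarrow> 'a set"
  shows "outer_content (\<Union>i. A i) \<le> (\<Sum>i. outer_content (A i))"
proof (rule ennreal_le_epsilon)
  fix \<epsilon> :: real assume \<epsilon>: "0 < \<epsilon>"
  have "\<exists>G. open G \<and> A n \<subseteq> G \<and> inner_content G \<le> outer_content (A n) + \<epsilon> * (1/2) ^ Suc n" for n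
    by (rule outer_content_approx[of "\<epsilon> * (1/2) ^ Suc n" "A n"]) (use \<epsilon> in auto)
  then obtain G where G: "\<And>n. open (G n)" "\<And>n. A n \<subseteq> G n"
    "\<And>n. inner_content (G n) \<le> outer_content (A n) + \<epsilon> * (1/2) ^ Suc n" by metis
  have "outer_content (\<Union>i. A i) \<le> inner_content (\<Union>i. G i)"
    using G(1,2) by (intro outer_content_le_inner open_UN UN_mono) auto
  also have "\<dots> \<le> (\<Sum>n. inner_content (G n))" using G(1) by (rule inner_content_UN_le)
  also have "\<dots> \<le> (\<Sum>n. outer_content (A n) + \<epsilon> * (1/2) ^ Suc n)"
    using G(3) by (intro suminf_le) auto
  also have "\<dots> = (\<Sum>n. outer_content (A n)) + (\<Sum>n. ennreal \<epsilon> * ennreal ((1/2) ^ Suc n))"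
    using \<epsilon> by (subst suminf_add[symmetric])
      (auto simp del: ennreal_suminf_cmult simp add: ennreal_mult[symmetric])
  also have "\<dots> = (\<Sum>n. outer_content (A n)) + \<epsilon>"
    unfolding ennreal_suminf_cmult
    by (subst suminf_ennreal_eq[OF zero_le_power power_half_series]) auto
  finally show "outer_content (\<Union>i. A i) \<le> (\<Sum>n. outer_content (A n)) + \<epsilon>" .
qed

lemma outer_content_empty: "outer_content {} = 0"
  using outer_content_open[of "{}"] positive by (simp add: inner_content_def positive_def)

lemma outer_measure_space_outer_content: "outer_measure_space (Pow UNIV) outer_content"
  unfolding outer_measure_space_def positive_def increasing_def countably_subadditive_def
  using outer_content_empty outer_content_mono outer_content_UN_le by auto

lemma compact_subsets_nonempty: "{K. compact K \<and> K \<subseteq> (S :: 'a set)} \<noteq> {}"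
  by (auto intro: exI[of _ "{}"])

lemma charge_add_inner_content_le:
  assumes "compact K" "K \<subseteq> H"
  shows "\<phi> K + inner_content (H - K) \<le> inner_content H"
proof -
  have "\<phi> K + \<phi> L \<le> inner_content H" if "compact L" "L \<subseteq> H - K" for L
  proof -
    have "\<phi> K + \<phi> L = \<phi> (K \<union> L)"
      using that(2) by (intro additiveD[OF additive, symmetric]) auto
    also have "\<dots> \<le> inner_content H"
      using assms that by (intro charge_le_inner_content compact_Un) auto
    finally show ?thesis .
  qed
  then have "(SUP L\<in>{L. compact L \<and> L \<subseteq> H - K}. \<phi> K + \<phi> L) \<le> inner_content H"
    by (intro SUP_least) auto
  then show ?thesis
    unfolding inner_content_def[of "H - K"] ennreal_SUP_add_right[OF compact_subsets_nonempty] .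
qed

lemma outer_content_split_open:
  assumes "open G"
  shows "outer_content (A \<inter> G) + outer_content (A - G) \<le> outer_content A"
proof (rule outer_content_geI)
  fix H assume H: "open H" "A \<subseteq> H"
  have compact_part: "\<phi> K + outer_content (H - G) \<le> inner_content H"
    if K: "compact K" "K \<subseteq> H \<inter> G" for K
  proof -
    have "outer_content (H - G) \<le> inner_content (H - K)"
      using K H(1) by (intro outer_content_le_inner open_Diff compact_imp_closed) auto
    then have "\<phi> K + outer_content (H - G) \<le> \<phi> K + inner_content (H - K)"
      by (rule add_left_mono)
    also have "\<dots> \<le> inner_content H" using K by (intro charge_add_inner_content_le) auto
    finally show ?thesis .
  qed
  have "outer_content (A \<inter> G) + outer_content (A - G) \<le> inner_content (H \<inter> G) + outer_content (H - G)"
    using H assms by (intro add_mono outer_content_le_inner outer_content_mono) auto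
  also have "\<dots> = (SUP K\<in>{K. compact K \<and> K \<subseteq> H \<inter> G}. \<phi> K + outer_content (H - G))"
    unfolding inner_content_def by (rule ennreal_SUP_add_left[OF compact_subsets_nonempty, symmetric])
  also have "\<dots> \<le> inner_content H" using compact_part by (intro SUP_least) auto
  finally show "outer_content (A \<inter> G) + outer_content (A - G) \<le> inner_content H" .
qed

lemma borel_subset_lambda_system:
  "sets borel \<subseteq> lambda_system UNIV (Pow UNIV) outer_content"
proof -
  have "subadditive (Pow UNIV) outer_content"
    using outer_measure_space_outer_content unfolding outer_measure_space_def
    by (intro countably_subadditive_subadditive) auto
  then have "outer_content A \<le> outer_content (A \<inter> G) + outer_content (A - G)" for A G
    using subadditiveD[of "Pow UNIV" outer_content "A \<inter> G" "A - G"] by (auto simp: Int_Diff_Un)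
  then have "{G. open G} \<subseteq> lambda_system UNIV (Pow UNIV) outer_content"
    unfolding lambda_system_eq by (auto intro!: antisym outer_content_split_open)
  moreover have "sigma_algebra UNIV (lambda_system UNIV (Pow UNIV) outer_content)"
    using caratheodory_lemma[OF outer_measure_space_outer_content] by (simp add: measure_space_def)
  ultimately show ?thesis
    unfolding borel_def by (auto dest: sigma_algebra.sigma_sets_subset simp: sets_measure_of)
qed

definition regularization :: "'a measure" where
  "regularization = measure_of UNIV (sets borel) outer_content"

lemma sets_regularization [simp]: "sets regularization = sets borel"
  unfolding regularization_def using sets.sets_measure_of_eq[of borel] by simp

lemma emeasure_regularization:
  assumes "A \<in> sets borel"
  shows "emeasure regularization A = outer_content A"
proof -
  have "sigma_algebra UNIV (sets borel :: 'a set set)"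
    using sets.sigma_algebra_axioms[of "borel :: 'a measure"] by simp
  moreover have "positive (sets borel) outer_content"
    by (simp add: positive_def outer_content_empty)
  moreover have "countably_additive (sets borel) outer_content"
    using caratheodory_lemma[OF outer_measure_space_outer_content] borel_subset_lambda_system
    unfolding measure_space_def countably_additive_def by blast
  ultimately show ?thesis
    unfolding regularization_def by (intro emeasure_measure_of_sigma assms)
qed

lemma prob_space_regularization:
  assumes "compact (UNIV :: 'a set)"
  shows "prob_space regularization"
proof (rule prob_spaceI)
  have "1 \<le> inner_content UNIV"
    using charge_le_inner_content[OF assms] total by simp
  then have "outer_content UNIV = 1"
    using inner_content_le_1[of UNIV] by (simp add: outer_content_open)
  moreover have "space regularization = UNIV"
    using sets_eq_imp_space_eq[OF sets_regularization] by simp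
  ultimately show "emeasure regularization (space regularization) = 1"
    by (simp add: emeasure_regularization)
qed

lemma outer_content_homeomorphism_image_le:
  assumes "homeomorphism UNIV UNIV f g" "\<And>E. \<phi> (f ` E) = \<phi> E"
  shows "outer_content (f ` A) \<le> outer_content A"
proof (rule outer_content_geI)
  fix G assume G: "open G" "A \<subseteq> G"
  have g_f: "f (g x) = x" for x using homeomorphism_apply2[OF assms(1)] by simp
  have "open (f ` G)" using homeomorphism_imp_open_map[OF assms(1)] G(1) by simp
  then have "outer_content (f ` A) \<le> inner_content (f ` G)"
    using G(2) by (intro outer_content_le_inner) auto
  also have "\<dots> \<le> inner_content G"
  proof (rule inner_content_leI)
    fix K assume K: "compact K" "K \<subseteq> f ` G"
    have "compact (g ` K)"
      using continuous_on_subset[OF homeomorphism_cont2[OF assms(1)]] K(1)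
      by (intro compact_continuous_image) auto
    moreover have "g ` K \<subseteq> G"
      using K(2) homeomorphism_apply1[OF assms(1)] by force
    ultimately have "\<phi> (g ` K) \<le> inner_content G" by (rule charge_le_inner_content)
    moreover have "\<phi> (g ` K) = \<phi> K"
      using assms(2)[of "g ` K"] by (simp add: image_image g_f)
    ultimately show "\<phi> K \<le> inner_content G" by simp
  qed
  finally show "outer_content (f ` A) \<le> inner_content G" .
qed

lemma outer_content_homeomorphism_image:
  assumes "homeomorphism UNIV UNIV f g" "\<And>E. \<phi> (f ` E) = \<phi> E"
  shows "outer_content (f ` A) = outer_content A"
proof (rule antisym)
  have "f (g x) = x" "g (f x) = x" for x
    using homeomorphism_apply1[OF assms(1)] homeomorphism_apply2[OF assms(1)] by simp_all
  then have "\<phi> (g ` E) = \<phi> E" "g ` f ` A = A" for E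
    using assms(2)[of "g ` E"] by (simp_all add: image_image)
  then show "outer_content A \<le> outer_content (f ` A)"
    using outer_content_homeomorphism_image_le[OF homeomorphism_symD[OF assms(1)], of "f ` A"] by simp
qed (rule outer_content_homeomorphism_image_le[OF assms])

lemma outer_content_le_of_neighbourhoods:
  assumes "compact (UNIV :: 'a set)" "closed C" "open U"
    and le: "\<And>W K. open W \<Longrightarrow> C \<subseteq> W \<Longrightarrow> closed K \<Longrightarrow> K \<subseteq> U \<Longrightarrow> \<phi> K \<le> \<phi> W"
  shows "outer_content U \<le> outer_content C"
  unfolding outer_content_open[OF assms(3)]
proof (intro outer_content_geI inner_content_leI)
  fix G K assume G: "open G" "C \<subseteq> G" and K: "compact K" "K \<subseteq> U"
  obtain W where W: "open W" "C \<subseteq> W" "closure W \<subseteq> G"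
    using closed_subset_open_closure[OF assms(2) G] .
  have "\<phi> K \<le> \<phi> W" using W K by (intro le compact_imp_closed)
  also have "\<dots> \<le> \<phi> (closure W)" by (rule charge_mono[OF closure_subset])
  also have "\<dots> \<le> inner_content G"
    using compact_Int_closed[OF assms(1), of "closure W"] W(3)
    by (intro charge_le_inner_content) auto
  finally show "\<phi> K \<le> inner_content G" .
qed

end

subsection \<open>Visits of an orbit and invariant charges\<close>

definition visits :: "('a \<Rightarrow> 'a) \<Rightarrow> 'a set \<Rightarrow> nat \<Rightarrow> 'a \<Rightarrow> nat" where
  "visits h A n x = (\<Sum>i<n. of_bool ((h ^^ i) x \<in> A))"

lemma visits_0 [simp]: "visits h A 0 x = 0"
  by (simp add: visits_def)

lemma visits_Suc [simp]: "visits h A (Suc n) x = visits h A n x + of_bool ((h ^^ n) x \<in> A)"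
  by (simp add: visits_def)

lemma visits_empty [simp]: "visits h {} n x = 0"
  by (simp add: visits_def)

lemma visits_UNIV [simp]: "visits h UNIV n x = n"
  by (simp add: visits_def)

lemma visits_mono: "A \<subseteq> B \<Longrightarrow> visits h A n x \<le> visits h B n x"
  unfolding visits_def by (intro sum_mono) auto

lemma visits_mono_length: "m \<le> n \<Longrightarrow> visits h A m x \<le> visits h A n x"
  unfolding visits_def by (intro sum_mono2) auto

lemma visits_Un_disjoint: "A \<inter> B = {} \<Longrightarrow> visits h (A \<union> B) n x = visits h A n x + visits h B n x"
  unfolding visits_def sum.distrib[symmetric] by (intro sum.cong) auto

lemma visits_vimage: "of_bool (x \<in> A) + visits h (h -` A) n x = visits h A (Suc n) x"
  unfolding visits_def sum.lessThan_Suc_shift by simp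

lemma visits_cong:
  assumes "\<And>i. i < n \<Longrightarrow> (h ^^ i) x \<in> A \<longleftrightarrow> (h ^^ i) y \<in> A"
  shows "visits h A n x = visits h A n y"
  unfolding visits_def using assms by (intro sum.cong) auto

lemma visits_attained:
  assumes "r < visits h A n x"
  obtains t where "t < n" "(h ^^ t) x \<in> A" "visits h A t x = r"
proof -
  have "\<exists>t<n. (h ^^ t) x \<in> A \<and> visits h A t x = r"
    using assms
  proof (induction n)
    case (Suc n)
    show ?case
    proof (cases "r < visits h A n x")
      case True
      then show ?thesis using Suc.IH less_SucI by blast
    next
      case False
      then have "(h ^^ n) x \<in> A" "visits h A n x = r"
        using Suc.prems by (auto simp: of_bool_def split: if_splits)
      then show ?thesis by blast
    qed
  qed simp
  then show ?thesis using that by blast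
qed

lemma visits_less_length: "(h ^^ m) x \<in> A \<Longrightarrow> m < n \<Longrightarrow> visits h A m x < visits h A n x"
  using visits_mono_length[of "Suc m" n h A x] by simp

lemma visits_inj:
  assumes "(h ^^ k) x \<in> A" "(h ^^ l) x \<in> A" "visits h A k x = visits h A l x"
  shows "k = l"
  using visits_less_length[of k h x A l] visits_less_length[of l h x A k] assms
  by (cases k l rule: linorder_cases) auto

definition visit_frequency :: "('a \<Rightarrow> 'a) \<Rightarrow> nat \<times> 'a \<Rightarrow> 'a set \<Rightarrow> real" where
  "visit_frequency h = (\<lambda>(n, x) E. real (visits h E n x) / real n)"

lemma visit_frequency_bounds: "visit_frequency h p E \<in> {0..1}"
  using visits_mono[of E UNIV h "fst p" "snd p"]
  by (auto simp: visit_frequency_def divide_le_eq split: prod.splits)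

lemma visit_frequency_Un_disjoint:
  "A \<inter> B = {} \<Longrightarrow> visit_frequency h p (A \<union> B) = visit_frequency h p A + visit_frequency h p B"
  by (auto simp: visit_frequency_def visits_Un_disjoint add_divide_distrib split: prod.splits)

lemma visit_frequency_vimage:
  "\<bar>visit_frequency h (n, x) (h -` E) - visit_frequency h (n, x) E\<bar> \<le> 1 / real n"
proof -
  have "\<bar>real (visits h (h -` E) n x) - real (visits h E n x)\<bar> \<le> 1"
    using visits_vimage[of x E h n] by (auto simp: of_bool_def split: if_splits)
  then have "\<bar>real (visits h (h -` E) n x) - real (visits h E n x)\<bar> / real n \<le> 1 / real n"
    by (intro divide_right_mono) auto
  then show ?thesis
    by (simp add: visit_frequency_def abs_divide flip: diff_divide_distrib)
qed

lemma eventually_visit_frequency_vimage: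
  assumes "filterlim fst at_top F" "0 < \<epsilon>"
  shows "\<forall>\<^sub>F p in F. \<bar>visit_frequency h p (h -` E) - visit_frequency h p E\<bar> \<le> \<epsilon>"
proof -
  obtain m where m: "1 / real (Suc m) < \<epsilon>" using nat_approx_posE assms(2) by blast
  have "\<forall>\<^sub>F p in F. Suc m \<le> fst p"
    using assms(1) unfolding filterlim_at_top by blast
  then show ?thesis
  proof eventually_elim
    case (elim p)
    have "1 / real (fst p) \<le> 1 / real (Suc m)"
      using elim by (intro divide_left_mono) auto
    then show ?case
      using visit_frequency_vimage[of h "fst p" "snd p" E] m by simp
  qed
qed

definition frequency_cluster :: "('a \<Rightarrow> 'a) \<Rightarrow> (nat \<times> 'a) filter \<Rightarrow> ('a set \<Rightarrow> real) \<Rightarrow> bool" where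
  "frequency_cluster h F \<psi> \<longleftrightarrow>
    (\<forall>S. closed S \<longrightarrow> (\<forall>\<^sub>F p in F. visit_frequency h p \<in> S) \<longrightarrow> \<psi> \<in> S)"

lemma ex_frequency_cluster:
  assumes "F \<noteq> bot"
  shows "\<exists>\<psi>. frequency_cluster h F \<psi>"
  unfolding frequency_cluster_def
  by (rule ex_cluster_function[OF assms visit_frequency_bounds])

lemma frequency_clusterD:
  assumes "frequency_cluster h F \<psi>" "closed {f. P f}" "\<forall>\<^sub>F p in F. P (visit_frequency h p)"
  shows "P \<psi>"
  using assms(1)[unfolded frequency_cluster_def, rule_format, of "{f. P f}"] assms(2,3) by simp

lemma frequency_cluster_nonneg:
  assumes "frequency_cluster h F \<psi>"
  shows "0 \<le> \<psi> E"
  using frequency_clusterD[OF assms, of "\<lambda>f. 0 \<le> f E"] visit_frequency_bounds[of h _ E]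
  by (simp add: closed_Collect_le)

lemma frequency_cluster_mono:
  assumes "frequency_cluster h F \<psi>" "\<forall>\<^sub>F (n, x) in F. visits h A n x \<le> visits h B n x"
  shows "\<psi> A \<le> \<psi> B"
proof (rule frequency_clusterD[OF assms(1)])
  show "closed {f. f A \<le> (f B :: real)}" by (simp add: closed_Collect_le)
  show "\<forall>\<^sub>F p in F. visit_frequency h p A \<le> visit_frequency h p B"
    using assms(2) by eventually_elim (auto simp: visit_frequency_def divide_right_mono)
qed

lemma frequency_cluster_vimage:
  assumes "frequency_cluster h F \<psi>" "filterlim fst at_top F"
  shows "\<psi> (h -` E) = \<psi> E"
proof -
  have "\<bar>\<psi> (h -` E) - \<psi> E\<bar> \<le> 0 + \<epsilon>" if "\<epsilon> > 0" for \<epsilon>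
  proof -
    have "closed {f. \<bar>f (h -` E) - (f E :: real)\<bar> \<le> \<epsilon>}"
      by (intro closed_Collect_le continuous_intros continuous_on_product_coordinates)
    then show ?thesis
      using frequency_clusterD[OF assms(1) _ eventually_visit_frequency_vimage[OF assms(2) that]]
      by simp
  qed
  then have "\<bar>\<psi> (h -` E) - \<psi> E\<bar> \<le> 0" by (rule field_le_epsilon)
  then show ?thesis by simp
qed

lemma frequency_cluster_UNIV:
  assumes "frequency_cluster h F \<psi>" "filterlim fst at_top F"
  shows "\<psi> UNIV = 1"
proof (rule frequency_clusterD[OF assms(1)])
  show "closed {f. f UNIV = (1 :: real)}" by (simp add: closed_Collect_eq)
  have "\<forall>\<^sub>F p in F. 1 \<le> fst p"
    using assms(2) unfolding filterlim_at_top by blast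
  then show "\<forall>\<^sub>F p in F. visit_frequency h p UNIV = 1"
    by eventually_elim (auto simp: visit_frequency_def split: prod.splits)
qed

lemma frequency_cluster_Un_disjoint:
  assumes "frequency_cluster h F \<psi>" "A \<inter> B = {}"
  shows "\<psi> (A \<union> B) = \<psi> A + \<psi> B"
proof (rule frequency_clusterD[OF assms(1)])
  show "closed {f. f (A \<union> B) = f A + (f B :: real)}"
    by (intro closed_Collect_eq continuous_intros continuous_on_product_coordinates)
qed (simp add: visit_frequency_Un_disjoint[OF assms(2)])

lemma probability_charge_frequency_cluster:
  fixes h :: "'a::metric_space \<Rightarrow> 'a"
  assumes "frequency_cluster h F \<psi>" "filterlim fst at_top F"
  shows "probability_charge (\<lambda>E. ennreal (\<psi> E))"
proof
  have "\<psi> {} = 0"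
    using frequency_cluster_Un_disjoint[OF assms(1), of "{}" "{}"] by simp
  then show "positive (Pow UNIV) (\<lambda>E. ennreal (\<psi> E))" by (simp add: positive_def)
  show "additive (Pow UNIV) (\<lambda>E. ennreal (\<psi> E))"
    using frequency_cluster_Un_disjoint[OF assms(1)] frequency_cluster_nonneg[OF assms(1)]
    by (simp add: additive_def)
  show "ennreal (\<psi> UNIV) = 1" using frequency_cluster_UNIV[OF assms] by simp
qed

definition eventually_fewer_visits :: "('a \<Rightarrow> 'a) \<Rightarrow> 'a set \<Rightarrow> 'a set \<Rightarrow> bool" where
  "eventually_fewer_visits h A B \<longleftrightarrow> (\<exists>N. \<forall>n\<ge>N. \<forall>x. visits h A n x < visits h B n x)"

definition violating_segments ::
  "('a \<Rightarrow> 'a) \<Rightarrow> 'a set \<Rightarrow> 'a set \<Rightarrow> nat \<Rightarrow> (nat \<times> 'a) set" where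
  "violating_segments h W K N = {(n, x). N \<le> n \<and> visits h K n x \<le> visits h W n x}"

lemma violating_segments_mono:
  assumes "W \<subseteq> W'" "K' \<subseteq> K" "N' \<le> N"
  shows "violating_segments h W K N \<subseteq> violating_segments h W' K' N'"
proof -
  have "visits h K' n x \<le> visits h W' n x" if "visits h K n x \<le> visits h W n x" for n x
    using visits_mono[OF assms(2), of h n x] that visits_mono[OF assms(1), of h n x] by linarith
  then show ?thesis using assms(3) by (auto simp: violating_segments_def)
qed

text \<open>As \<open>W\<close> shrinks to \<open>C\<close>, \<open>K\<close> grows to \<open>U\<close> and \<open>N\<close> tends to infinity, the sets of violating
  segments form a filter base.\<close>

lemma ex_filter_of_violating_segments:
  fixes h :: "'a::topological_space \<Rightarrow> 'a"
  assumes "\<nexists>W K. open W \<and> C \<subseteq> W \<and> closed K \<and> K \<subseteq> U \<and> eventually_fewer_visits h W K"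
  shows "\<exists>F. F \<noteq> bot \<and> (\<forall>W K N. open W \<longrightarrow> C \<subseteq> W \<longrightarrow> closed K \<longrightarrow> K \<subseteq> U \<longrightarrow>
    (\<forall>\<^sub>F p in F. p \<in> violating_segments h W K N))"
proof -
  define I where "I = {(W, K, N :: nat). open W \<and> C \<subseteq> W \<and> closed K \<and> K \<subseteq> U}"
  define S where "S = (\<lambda>(W, K, N). violating_segments h W K N)"
  have "\<exists>F. F \<noteq> bot \<and> (\<forall>i\<in>I. \<forall>\<^sub>F p in F. p \<in> S i)"
  proof (rule ex_filter_of_directed_family)
    have "(UNIV, {}, 0) \<in> I" by (simp add: I_def)
    then show "I \<noteq> {}" by blast
  next
    fix i assume i: "i \<in> I"
    obtain W K N where eq: "i = (W, K, N)" by (metis prod_cases3)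
    then have "open W" "C \<subseteq> W" "closed K" "K \<subseteq> U" using i by (simp_all add: I_def)
    then have "\<not> (\<forall>n\<ge>N. \<forall>x. visits h W n x < visits h K n x)"
      using assms unfolding eventually_fewer_visits_def by blast
    then show "S i \<noteq> {}" by (auto simp: S_def eq violating_segments_def not_less)
  next
    fix i j assume ij: "i \<in> I" "j \<in> I"
    obtain W K N W' K' N' where eq: "i = (W, K, N)" "j = (W', K', N')" by (metis prod_cases3)
    have "(W \<inter> W', K \<union> K', max N N') \<in> I" using ij unfolding eq I_def by auto
    moreover have "S (W \<inter> W', K \<union> K', max N N') \<subseteq> S i \<inter> S j"
      unfolding S_def eq prod.case by (intro Int_greatest violating_segments_mono) auto
    ultimately show "\<exists>k\<in>I. S k \<subseteq> S i \<inter> S j" by blast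
  qed
  then obtain F where "F \<noteq> bot" and F: "\<forall>i\<in>I. \<forall>\<^sub>F p in F. p \<in> S i" by blast
  have "\<forall>\<^sub>F p in F. p \<in> violating_segments h W K N"
    if "open W" "C \<subseteq> W" "closed K" "K \<subseteq> U" for W K N
    using bspec[OF F, of "(W, K, N)"] that by (simp add: I_def S_def)
  then show ?thesis using \<open>F \<noteq> bot\<close> by blast
qed

lemma ex_invariant_charge_of_violating_segments:
  fixes h :: "'a::metric_space \<Rightarrow> 'a"
  assumes "\<nexists>W K. open W \<and> C \<subseteq> W \<and> closed K \<and> K \<subseteq> U \<and> eventually_fewer_visits h W K"
  shows "\<exists>\<phi>. probability_charge \<phi> \<and> (\<forall>E. \<phi> (h -` E) = \<phi> E) \<and>
    (\<forall>W K. open W \<longrightarrow> C \<subseteq> W \<longrightarrow> closed K \<longrightarrow> K \<subseteq> U \<longrightarrow> \<phi> K \<le> \<phi> W)"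
proof -
  from ex_filter_of_violating_segments[OF assms] obtain F where "F \<noteq> bot"
    and F: "\<forall>W K N. open W \<longrightarrow> C \<subseteq> W \<longrightarrow> closed K \<longrightarrow> K \<subseteq> U \<longrightarrow>
      (\<forall>\<^sub>F p in F. p \<in> violating_segments h W K N)"
    by (elim exE conjE) (rule that)
  have long: "filterlim fst at_top F"
    unfolding filterlim_at_top
  proof
    fix N
    have "\<forall>\<^sub>F p in F. p \<in> violating_segments h UNIV {} N" using F by simp
    then show "\<forall>\<^sub>F p in F. N \<le> fst p"
      by (rule eventually_mono) (auto simp: violating_segments_def)
  qed
  obtain \<psi> where \<psi>: "frequency_cluster h F \<psi>" using ex_frequency_cluster[OF \<open>F \<noteq> bot\<close>] by blast
  have "\<psi> K \<le> \<psi> W" if "open W" "C \<subseteq> W" "closed K" "K \<subseteq> U" for W K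
  proof (rule frequency_cluster_mono[OF \<psi>])
    have "\<forall>\<^sub>F p in F. p \<in> violating_segments h W K 0" using F that by simp
    then show "\<forall>\<^sub>F (n, x) in F. visits h K n x \<le> visits h W n x"
      by (rule eventually_mono) (auto simp: violating_segments_def)
  qed
  then show ?thesis
    using probability_charge_frequency_cluster[OF \<psi> long] frequency_cluster_vimage[OF \<psi> long]
    by (intro exI[of _ "\<lambda>E. ennreal (\<psi> E)"]) (auto intro: ennreal_leI)
qed

subsection \<open>Powers of a homeomorphism\<close>

locale homeo =
  fixes h :: "'a::metric_space \<Rightarrow> 'a"
  assumes homeomorphism: "homeomorphism UNIV UNIV h (inv h)"
begin

abbreviation T :: "int \<Rightarrow> 'a \<Rightarrow> 'a" where "T \<equiv> hpow h"

lemma inv_h_h [simp]: "inv h (h x) = x" and h_inv_h [simp]: "h (inv h x) = x"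
  using homeomorphism_apply1[OF homeomorphism] homeomorphism_apply2[OF homeomorphism] by simp_all

lemma bij: "bij h"
  by (rule o_bij[of "inv h"]) (simp_all add: fun_eq_iff)

lemma T_of_nat: "T (int n) x = (h ^^ n) x"
  by (simp add: hpow_def)

lemma T_0 [simp]: "T 0 x = x"
  by (simp add: hpow_def)

lemma T_1 [simp]: "T 1 x = h x"
  by (simp add: hpow_def)

lemma T_succ: "T (i + 1) x = h (T i x)"
proof (cases i rule: int_cases)
  case (nonneg n)
  then show ?thesis by (simp add: hpow_def nat_add_distrib)
next
  case (neg n)
  have "T (- int (Suc n)) = inv h ^^ Suc n" "T (- int n) = inv h ^^ n"
    unfolding hpow_def by (auto simp: nat_add_distrib)
  then show ?thesis unfolding neg by simp
qed

lemma T_pred: "T (i - 1) x = inv h (T i x)"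
  using T_succ[of "i - 1" x] by simp

lemma T_add: "T (i + j) x = T i (T j x)"
proof (induction i rule: int_induct[where k = 0])
  case base
  show ?case by simp
next
  case (step1 i)
  then show ?case using T_succ[of "i + j" x] T_succ[of i "T j x"] by (simp add: algebra_simps)
next
  case (step2 i)
  then show ?case using T_pred[of "i + j" x] T_pred[of i "T j x"] by (simp add: algebra_simps)
qed

lemma T_T: "T i (T j x) = T (i + j) x"
  by (simp add: T_add)

lemma T_neg_cancel [simp]: "T (- i) (T i x) = x" "T i (T (- i) x) = x"
  by (simp_all add: T_T)

lemma T_image_eq_vimage: "T i ` S = T (- i) -` S"
  by (auto intro: rev_image_eqI)

lemma continuous_T: "continuous_on UNIV (T i)"
proof (induction i rule: int_induct[where k = 0])
  case base
  have "T 0 = (\<lambda>x. x)" by (simp add: fun_eq_iff)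
  then show ?case by simp
next
  case (step1 i)
  have "T (i + 1) = (\<lambda>x. h (T i x))" by (simp add: fun_eq_iff T_succ)
  then show ?case
    using continuous_on_compose2[OF homeomorphism_cont1[OF homeomorphism] step1(2)] by simp
next
  case (step2 i)
  have "T (i - 1) = (\<lambda>x. inv h (T i x))" by (simp add: fun_eq_iff T_pred)
  then show ?case
    using continuous_on_compose2[OF homeomorphism_cont2[OF homeomorphism] step2(2)] by simp
qed

lemma open_T_vimage: "open S \<Longrightarrow> open (T i -` S)"
  by (rule open_vimage[OF _ continuous_T])

lemma closed_T_vimage: "closed S \<Longrightarrow> closed (T i -` S)"
  by (rule closed_vimage[OF _ continuous_T])

lemma closed_T_image: "closed S \<Longrightarrow> closed (T i ` S)"
  by (simp add: T_image_eq_vimage closed_T_vimage)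

end

locale compact_homeo = homeo h for h :: "'a::metric_space \<Rightarrow> 'a" +
  assumes compact_UNIV: "compact (UNIV :: 'a set)"
begin

lemma closed_imp_compact: "closed (S :: 'a set) \<Longrightarrow> compact S"
  using compact_Int_closed[OF compact_UNIV] by simp

subsection \<open>Invariant measures bound visits\<close>

lemma regularization_in_inv_measures:
  assumes "probability_charge \<phi>" "\<And>E. \<phi> (h -` E) = \<phi> E"
  shows "probability_charge.regularization \<phi> \<in> inv_measures h"
proof -
  interpret probability_charge \<phi> by fact
  have invariant: "outer_content (h -` A) = outer_content A" for A
    using outer_content_homeomorphism_image[OF homeomorphism_symD[OF homeomorphism]] assms(2)
    by (simp add: bij_vimage_eq_inv_image[OF bij])
  have "h -` A \<in> sets borel" if "A \<in> sets borel" for A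
    using measurable_sets[OF borel_measurable_continuous_onI[OF homeomorphism_cont1[OF homeomorphism]] that]
    by simp
  then show ?thesis
    using prob_space_regularization[OF compact_UNIV]
    by (simp add: inv_measures_def emeasure_regularization invariant)
qed

lemma ex_neighbourhoods_fewer_visits:
  assumes C: "closed C" and U: "open U"
    and less: "\<forall>\<mu>\<in>inv_measures h. emeasure \<mu> C < emeasure \<mu> U"
  shows "\<exists>W K. open W \<and> C \<subseteq> W \<and> closed K \<and> K \<subseteq> U \<and> eventually_fewer_visits h W K"
proof (rule ccontr)
  assume "\<not> ?thesis"
  from ex_invariant_charge_of_violating_segments[OF this]
  obtain \<phi> where charge: "probability_charge \<phi>" and invariant: "\<forall>E. \<phi> (h -` E) = \<phi> E"
    and le: "\<forall>W K. open W \<longrightarrow> C \<subseteq> W \<longrightarrow> closed K \<longrightarrow> K \<subseteq> U \<longrightarrow> \<phi> K \<le> \<phi> W"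
    by (elim exE conjE) (rule that)
  interpret probability_charge \<phi> by (rule charge)
  have "emeasure regularization U \<le> emeasure regularization C"
    using outer_content_le_of_neighbourhoods[OF compact_UNIV C U] le C U
    by (simp add: emeasure_regularization)
  moreover have "regularization \<in> inv_measures h"
    using regularization_in_inv_measures[OF charge] invariant by simp
  ultimately show False using less not_le by blast
qed

end

lemma (in homeo) emeasure_singleton_eq_0:
  assumes inj: "inj (\<lambda>n. (h ^^ n) x)" and \<mu>: "\<mu> \<in> inv_measures h"
  shows "emeasure \<mu> {x} = 0"
proof -
  have sets: "sets \<mu> = sets borel" and "prob_space \<mu>"
    and invariant: "\<And>A. A \<in> sets borel \<Longrightarrow> emeasure \<mu> (h -` A) = emeasure \<mu> A"
    using \<mu> by (auto simp: inv_measures_def)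
  interpret prob_space \<mu> by fact
  have "h -` {h y} = {y}" for y
    using bij by (auto simp: bij_def inj_def)
  then have step: "measure \<mu> {h y} = measure \<mu> {y}" for y
    using invariant[of "{h y}"] by (simp add: measure_def)
  have "measure \<mu> {(h ^^ n) x} = measure \<mu> {x}" for n
    by (induction n) (simp_all add: step)
  moreover have "(\<lambda>n. measure \<mu> {(h ^^ n) x}) sums measure \<mu> (\<Union>n. {(h ^^ n) x})"
    using inj by (intro finite_measure_UNION) (auto simp: sets disjoint_family_on_def inj_def)
  ultimately have "summable (\<lambda>_ :: nat. measure \<mu> {x})"
    by (simp add: sums_summable)
  then show ?thesis by (simp add: summable_const_iff emeasure_eq_measure)
qed

subsection \<open>Moving sets piecewise by powers of the homeomorphism\<close>

context homeo
begin

text \<open>The pieces are indexed by the power of \<open>h\<close> that moves them; this loses nothing, since pieces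
  moved by the same power can be merged.\<close>

definition packing :: "(int \<Rightarrow> 'a set) \<Rightarrow> 'a set \<Rightarrow> bool" where
  "packing K V \<longleftrightarrow> finite {d. K d \<noteq> {}} \<and> (\<forall>d. T d ` K d \<subseteq> V) \<and> disjoint_family (\<lambda>d. T d ` K d)"

definition subequiv :: "'a set \<Rightarrow> 'a set \<Rightarrow> bool" where
  "subequiv C V \<longleftrightarrow> (\<exists>K. packing K V \<and> (\<forall>d. closed (K d)) \<and> C \<subseteq> (\<Union>d. K d))"

lemma packing_subset:
  assumes "packing K V" "\<And>d. L d \<subseteq> K d"
  shows "packing L V"
  unfolding packing_def
proof (intro conjI allI)
  have "{d. L d \<noteq> {}} \<subseteq> {d. K d \<noteq> {}}" using assms(2) by blast
  then show "finite {d. L d \<noteq> {}}"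
    using assms(1) finite_subset by (auto simp: packing_def)
  show "T d ` L d \<subseteq> V" for d
    using assms image_mono[OF assms(2)[of d], of "T d"] unfolding packing_def by blast
  show "disjoint_family (\<lambda>d. T d ` L d)"
    using assms(1) by (intro disjoint_family_subset[OF _ image_mono[OF assms(2)]]) (simp add: packing_def)
qed

lemma packing_Un:
  assumes "packing K V" "packing L W" "V \<inter> W = {}"
  shows "packing (\<lambda>d. K d \<union> L d) (V \<union> W)"
  unfolding packing_def
proof (intro conjI allI)
  have "{d. K d \<union> L d \<noteq> {}} = {d. K d \<noteq> {}} \<union> {d. L d \<noteq> {}}" by auto
  then show "finite {d. K d \<union> L d \<noteq> {}}" using assms(1,2) by (simp add: packing_def)
  show "T d ` (K d \<union> L d) \<subseteq> V \<union> W" for d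
    using assms(1,2) unfolding packing_def image_Un by (intro Un_mono) auto
  show "disjoint_family (\<lambda>d. T d ` (K d \<union> L d))"
    unfolding disjoint_family_on_def
  proof (intro ballI impI)
    fix d e :: int assume "d \<noteq> e"
    then have "T d ` K d \<inter> T e ` K e = {}" "T d ` L d \<inter> T e ` L e = {}"
      using assms(1,2) unfolding packing_def disjoint_family_on_def by simp_all
    moreover have "T d ` K d \<subseteq> V" "T e ` K e \<subseteq> V" "T d ` L d \<subseteq> W" "T e ` L e \<subseteq> W"
      using assms(1,2) unfolding packing_def by simp_all
    then have "T d ` K d \<inter> T e ` L e = {}" "T d ` L d \<inter> T e ` K e = {}"
      using assms(3) by blast+
    ultimately show "T d ` (K d \<union> L d) \<inter> T e ` (K e \<union> L e) = {}"
      by (simp add: image_Un Int_Un_distrib Int_Un_distrib2)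
  qed
qed

lemma subequiv_mono: "subequiv C V \<Longrightarrow> B \<subseteq> C \<Longrightarrow> V \<subseteq> W \<Longrightarrow> subequiv B W"
  unfolding subequiv_def packing_def by (meson order_trans)

lemma subequiv_empty: "subequiv {} V"
  unfolding subequiv_def packing_def
  by (intro exI[of _ "\<lambda>_. {}"]) (simp add: disjoint_family_on_def)

lemma subequiv_Un:
  assumes "subequiv C V" "subequiv D W" "V \<inter> W = {}"
  shows "subequiv (C \<union> D) (V \<union> W)"
proof -
  obtain K L where "packing K V" "\<forall>d. closed (K d)" "C \<subseteq> (\<Union>d. K d)"
    and "packing L W" "\<forall>d. closed (L d)" "D \<subseteq> (\<Union>d. L d)"
    using assms(1,2) unfolding subequiv_def by blast
  then show ?thesis
    unfolding subequiv_def
    by (intro exI[of _ "\<lambda>d. K d \<union> L d"]) (auto intro: packing_Un[OF _ _ assms(3)])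
qed

lemma packing_open_enlargement:
  assumes K: "packing K V" and closed: "\<And>d. closed (K d)" and V: "open V"
  obtains W where "\<And>d. open (W d)" "\<And>d. K d \<subseteq> W d" "packing (\<lambda>d. closure (W d)) V"
proof -
  define D where "D = {d. K d \<noteq> {}}"
  have "finite D" using K by (simp add: packing_def D_def)
  have "\<exists>N. (\<forall>d\<in>D. open (N d) \<and> T d ` K d \<subseteq> N d \<and> closure (N d) \<subseteq> V) \<and>
    disjoint_family_on (\<lambda>d. closure (N d)) D"
  proof (rule finite_disjoint_closed_neighbourhoods[OF \<open>finite D\<close>])
    show "disjoint_family_on (\<lambda>d. T d ` K d) D"
      using K by (auto simp: packing_def intro: disjoint_family_on_mono)
  qed (use K closed V in \<open>auto simp: packing_def intro: closed_T_image\<close>)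
  then obtain N where
    N: "\<And>d. d \<in> D \<Longrightarrow> open (N d)" "\<And>d. d \<in> D \<Longrightarrow> T d ` K d \<subseteq> N d"
      "\<And>d. d \<in> D \<Longrightarrow> closure (N d) \<subseteq> V"
    and disjoint: "disjoint_family_on (\<lambda>d. closure (N d)) D"
    by blast
  define W where "W d = (if d \<in> D then T d -` N d else {})" for d
  define C where "C d = (if d \<in> D then T d -` closure (N d) else {})" for d
  have T_C: "T d ` C d = (if d \<in> D then closure (N d) else {})" for d
    using T_image_eq_vimage[of d "C d"] by (auto simp: C_def vimage_def)
  show ?thesis
  proof (rule that[of W])
    show "open (W d)" for d
      using N(1) by (simp add: W_def open_T_vimage)
    show "K d \<subseteq> W d" for d
      using N(2)[of d] by (auto simp: W_def D_def)
    have "{d. C d \<noteq> {}} \<subseteq> D" by (auto simp: C_def)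
    then have "packing C V"
      using \<open>finite D\<close> N(3) disjoint
      by (auto simp: packing_def T_C disjoint_family_on_def intro: finite_subset)
    moreover have "closure (W d) \<subseteq> C d" for d
      using closure_subset[of "N d"]
      by (intro closure_minimal) (auto simp: W_def C_def closed_T_vimage)
    ultimately show "packing (\<lambda>d. closure (W d)) V" by (rule packing_subset)
  qed
qed

lemma subequiv_openE:
  assumes "subequiv C V" "open V"
  obtains Q where "open Q" "C \<subseteq> Q" "subequiv Q V"
proof -
  obtain K where K: "packing K V" "\<And>d. closed (K d)" "C \<subseteq> (\<Union>d. K d)"
    using assms(1) unfolding subequiv_def by blast
  obtain W where W: "\<And>d. open (W d)" "\<And>d. K d \<subseteq> W d" "packing (\<lambda>d. closure (W d)) V"
    using packing_open_enlargement[OF K(1,2) assms(2)] by blast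
  show ?thesis
  proof (rule that[of "\<Union>d. W d"])
    show "open (\<Union>d. W d)" using W(1) by blast
    show "C \<subseteq> (\<Union>d. W d)" using K(3) W(2) by blast
    show "subequiv (\<Union>d. W d) V"
      unfolding subequiv_def using W(3)
      by (intro exI[of _ "\<lambda>d. closure (W d)"]) (auto intro: subsetD[OF closure_subset])
  qed
qed

lemma subequiv_packing_Diff:
  assumes "packing M V" "open Q" "\<And>d. frontier (M d) \<subseteq> Q"
  shows "subequiv ((\<Union>d. M d) - Q) V"
  unfolding subequiv_def
proof (intro exI[of _ "\<lambda>d. closure (M d) - Q"] conjI allI)
  have "closure (M d) - Q \<subseteq> M d" for d
    using assms(3)[of d] closure_Un_frontier[of "M d"] by blast
  then show "packing (\<lambda>d. closure (M d) - Q) V" by (rule packing_subset[OF assms(1)])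
  show "closed (closure (M d) - Q)" for d using assms(2) by (intro closed_Diff) auto
  show "(\<Union>d. M d) - Q \<subseteq> (\<Union>d. closure (M d) - Q)" using closure_subset by blast
qed

lemma supp_fun_translate_subset:
  assumes "\<And>x. x \<notin> W \<Longrightarrow> f x = 0"
  shows "supp_fun (f \<circ> T (- d)) \<subseteq> T d ` closure W"
  unfolding supp_fun_def T_image_eq_vimage
  using assms closure_subset[of W] by (intro closure_minimal closed_T_vimage) auto

lemma subequiv_imp_comparison_functions:
  assumes "subequiv C U" "open U"
  shows "\<exists>(M :: nat) (f :: nat \<Rightarrow> 'a \<Rightarrow> real) (d :: nat \<Rightarrow> int).
    (\<forall>j\<le>M. continuous_on UNIV (f j) \<and> (\<forall>x. 0 \<le> f j x \<and> f j x \<le> 1)) \<and>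
    (\<forall>x\<in>C. (\<Sum>j\<le>M. f j x) = 1) \<and>
    (\<forall>j\<le>M. supp_fun (f j \<circ> T (- d j)) \<subseteq> U) \<and>
    (\<forall>j\<le>M. \<forall>k\<le>M. j \<noteq> k \<longrightarrow> supp_fun (f j \<circ> T (- d j)) \<inter> supp_fun (f k \<circ> T (- d k)) = {})"
proof -
  obtain K where K: "packing K U" "\<And>d. closed (K d)" "C \<subseteq> (\<Union>d. K d)"
    using assms(1) unfolding subequiv_def by blast
  obtain W where W: "\<And>d. open (W d)" "\<And>d. K d \<subseteq> W d" "packing (\<lambda>d. closure (W d)) U"
    using packing_open_enlargement[OF K(1,2) assms(2)] by blast
  define D where "D = insert 0 {d. K d \<noteq> {}}"
  have "finite D" using K(1) by (simp add: D_def packing_def)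
  then obtain f :: "int \<Rightarrow> 'a \<Rightarrow> real" where f: "\<And>d. continuous_on UNIV (f d)"
    "\<And>d x. d \<in> D \<Longrightarrow> f d x \<in> {0..1}" "\<And>d x. x \<notin> W d \<Longrightarrow> f d x = 0"
    "\<And>x. x \<in> (\<Union>d\<in>D. K d) \<Longrightarrow> (\<Sum>d\<in>D. f d x) = 1"
    using partition_of_unity_on_closed_family[of D K W] K(2) W(1,2) by metis
  have "{0..<card D} = {..card D - 1}"
    using \<open>finite D\<close> card_gt_0_iff[of D] by (auto simp: D_def)
  then obtain e where e: "bij_betw e {..card D - 1} D"
    using ex_bij_betw_nat_finite[OF \<open>finite D\<close>] by metis
  have supp: "supp_fun (f d \<circ> T (- d)) \<subseteq> T d ` closure (W d)" for d
    using f(3) by (rule supp_fun_translate_subset)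
  show ?thesis
  proof (intro exI[of _ "card D - 1"] exI[of _ "\<lambda>j. f (e j)"] exI[of _ e] conjI allI ballI impI)
    fix j assume "j \<le> card D - 1"
    then have "e j \<in> D" using e by (auto simp: bij_betw_def)
    then show "0 \<le> f (e j) x" "f (e j) x \<le> 1" for x using f(2)[of "e j" x] by auto
    show "supp_fun (f (e j) \<circ> T (- e j)) \<subseteq> U"
      using supp W(3) unfolding packing_def by (meson order_trans)
    fix k assume "k \<le> card D - 1" "j \<noteq> k"
    then have "e j \<noteq> e k" using e \<open>j \<le> card D - 1\<close> by (auto simp: bij_betw_def inj_on_def)
    then have "T (e j) ` closure (W (e j)) \<inter> T (e k) ` closure (W (e k)) = {}"
      using W(3) by (simp add: packing_def disjoint_family_on_def)
    then show "supp_fun (f (e j) \<circ> T (- e j)) \<inter> supp_fun (f (e k) \<circ> T (- e k)) = {}"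
      using supp[of "e j"] supp[of "e k"] by blast
  next
    fix x assume "x \<in> C"
    then have "x \<in> (\<Union>d\<in>D. K d)" using K(3) by (auto simp: D_def)
    then show "(\<Sum>j\<le>card D - 1. f (e j) x) = 1"
      using f(4) sum.reindex_bij_betw[OF e, of "\<lambda>d. f d x"] by simp
  qed (rule f(1))
qed

subsection \<open>Sets meeting every orbit boundedly often\<close>

definition hitting_times :: "'a set \<Rightarrow> 'a \<Rightarrow> int set" where
  "hitting_times F x = {d. T d x \<in> F}"

definition small :: "nat \<Rightarrow> 'a set \<Rightarrow> bool" where
  "small m F \<longleftrightarrow> (\<forall>x. finite (hitting_times F x) \<and> card (hitting_times F x) \<le> m)"

lemma top_small_imp_small:
  assumes "top_small h F"
  obtains m where "small m F"
proof -
  obtain m where m: "\<And>d :: nat \<Rightarrow> int. inj_on d {0..m} \<Longrightarrow> (\<Inter>j\<in>{0..m}. T (d j) ` F) = {}"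
    using assms unfolding top_small_def by blast
  have "card D \<noteq> Suc m" if D: "D \<subseteq> hitting_times F x" "finite D" for D x
  proof
    assume "card D = Suc m"
    then obtain f where f: "bij_betw f {0..<Suc m} D"
      using ex_bij_betw_nat_finite[OF D(2)] by metis
    then have "inj_on (\<lambda>j. - f j) {0..m}" by (auto simp: bij_betw_def inj_on_def)
    then have "(\<Inter>j\<in>{0..m}. T (- f j) ` F) = {}" by (rule m)
    moreover have "x \<in> T (- f j) ` F" if "j \<in> {0..m}" for j
    proof -
      have "f j \<in> D" using f that by (auto simp: bij_betw_def)
      then show ?thesis using D(1) by (auto simp: T_image_eq_vimage hitting_times_def)
    qed
    ultimately show False by blast
  qed
  then have few: "\<nexists>D. D \<subseteq> hitting_times F x \<and> finite D \<and> card D = Suc m" for x by blast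
  have "finite (hitting_times F x)" for x
    using few infinite_arbitrarily_large by blast
  moreover have "card (hitting_times F x) \<le> m" for x
    using few obtain_subset_with_card_n[of "Suc m" "hitting_times F x"] by (metis not_less_eq_eq)
  ultimately show ?thesis using that unfolding small_def by blast
qed

lemma small_0_iff: "small 0 F \<longleftrightarrow> F = {}"
proof
  assume "small 0 F"
  then have "hitting_times F x = {}" for x
    unfolding small_def by (metis card_0_eq le_zero_eq)
  then have "T 0 x \<notin> F" for x unfolding hitting_times_def by blast
  then show "F = {}" by auto
qed (simp add: small_def hitting_times_def)

lemma small_Un:
  assumes "small m F" "small n G"
  shows "small (m + n) (F \<union> G)"
  unfolding small_def
proof
  fix x
  have "hitting_times (F \<union> G) x = hitting_times F x \<union> hitting_times G x"
    by (auto simp: hitting_times_def)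
  then show "finite (hitting_times (F \<union> G) x) \<and> card (hitting_times (F \<union> G) x) \<le> m + n"
    using assms card_Un_le[of "hitting_times F x" "hitting_times G x"]
    unfolding small_def by (metis add_mono finite_UnI order_trans)
qed

lemma small_UN:
  assumes "finite I" "\<And>i. i \<in> I \<Longrightarrow> \<exists>m. small m (F i)"
  shows "\<exists>m. small m (\<Union>i\<in>I. F i)"
  using assms
proof (induction I rule: finite_induct)
  case empty
  then show ?case using small_0_iff by auto
next
  case (insert i I)
  then obtain m n where "small m (F i)" "small n (\<Union>i\<in>I. F i)" by blast
  then have "small (m + n) (\<Union>i\<in>insert i I. F i)" using small_Un by simp
  then show ?case by blast
qed

lemma small_T_vimage:
  assumes "small m F"
  shows "small m (T i -` F)"
  unfolding small_def
proof
  fix x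
  have "bij_betw (\<lambda>d. d + i) (hitting_times (T i -` F) x) (hitting_times F x)"
    by (rule bij_betwI[where g = "\<lambda>d. d - i"]) (auto simp: hitting_times_def T_T add.commute)
  then show "finite (hitting_times (T i -` F) x) \<and> card (hitting_times (T i -` F) x) \<le> m"
    using assms by (simp add: small_def bij_betw_finite bij_betw_same_card)
qed

lemma small_Int_T_vimage:
  assumes "small (Suc m) F" "e \<noteq> 0"
  shows "small m (F \<inter> T e -` F)"
  unfolding small_def
proof
  fix x
  define S where "S = hitting_times F x"
  have S: "finite S" "card S \<le> Suc m" using assms(1) by (auto simp: small_def S_def)
  have returning: "hitting_times (F \<inter> T e -` F) x = {d \<in> S. d + e \<in> S}"
    by (auto simp: S_def hitting_times_def T_T add.commute)
  have "card {d \<in> S. d + e \<in> S} \<le> m"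
  proof (cases "S = {}")
    case False
    have "{d \<in> S. d + e \<in> S} \<noteq> S"
    proof
      assume "{d \<in> S. d + e \<in> S} = S"
      then have "Max S + e \<in> S" "Min S + e \<in> S"
        using Max_in[OF S(1) False] Min_in[OF S(1) False] by blast+
      then show False
        using Max_ge[OF S(1), of "Max S + e"] Min_le[OF S(1), of "Min S + e"] assms(2) by simp
    qed
    then have "{d \<in> S. d + e \<in> S} \<subset> S" by blast
    then have "card {d \<in> S. d + e \<in> S} < card S" by (rule psubset_card_mono[OF S(1)])
    then show ?thesis using S(2) by simp
  qed simp
  then show "finite (hitting_times (F \<inter> T e -` F) x) \<and> card (hitting_times (F \<inter> T e -` F) x) \<le> m"
    using S(1) by (simp add: returning)
qed

definition thin :: "'a set \<Rightarrow> bool" where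
  "thin F \<longleftrightarrow> (\<forall>V. open V \<longrightarrow> V \<noteq> {} \<longrightarrow> subequiv F V)"

lemma subequiv_modulo_thin:
  assumes "thin F" "open V" "V \<noteq> {}" "V \<inter> W = {}"
    and rest: "\<And>Q. open Q \<Longrightarrow> F \<subseteq> Q \<Longrightarrow> subequiv (C - Q) W"
  shows "subequiv C (V \<union> W)"
proof -
  obtain Q where Q: "open Q" "F \<subseteq> Q" "subequiv Q V"
    using subequiv_openE assms(1-3) unfolding thin_def by blast
  have "subequiv (Q \<union> (C - Q)) (V \<union> W)"
    using Q(3) rest[OF Q(1,2)] assms(4) by (rule subequiv_Un)
  then show ?thesis by (rule subequiv_mono) auto
qed

subsection \<open>Matching along orbit blocks\<close>

text \<open>Visits to \<open>Y\<close> cut an orbit into blocks.  In the block starting at \<open>y\<close>, the point of \<open>A\<close> at height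
  \<open>k\<close> is paired with the point of \<open>B\<close> at height \<open>t\<close> that has the same rank.\<close>

definition paired :: "'a set \<Rightarrow> 'a set \<Rightarrow> 'a set \<Rightarrow> 'a \<Rightarrow> nat \<Rightarrow> nat \<Rightarrow> bool" where
  "paired A B Y y k t \<longleftrightarrow> y \<in> Y \<and> (\<forall>j. 0 < j \<longrightarrow> j \<le> max k t \<longrightarrow> (h ^^ j) y \<notin> Y) \<and>
    (h ^^ k) y \<in> A \<and> (h ^^ t) y \<in> B \<and> visits h B t y = visits h A k y"

definition matched :: "'a set \<Rightarrow> 'a set \<Rightarrow> 'a set \<Rightarrow> nat \<Rightarrow> int \<Rightarrow> 'a set" where
  "matched A B Y R d =
    {x. \<exists>k\<le>R. \<exists>t\<le>R. d = int t - int k \<and> paired A B Y (T (- int k) x) k t}"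

lemma matchedE:
  assumes "x \<in> matched A B Y R d"
  obtains y k t where "k \<le> R" "t \<le> R" "d = int t - int k" "paired A B Y y k t"
    "x = (h ^^ k) y" "T d x = (h ^^ t) y"
proof -
  obtain k t where kt: "k \<le> R" "t \<le> R" "d = int t - int k" "paired A B Y (T (- int k) x) k t"
    using assms unfolding matched_def by blast
  then show ?thesis by (intro that) (auto simp: T_T simp flip: T_of_nat)
qed

lemma paired_height_le:
  assumes "paired A B Y y k t" "paired A B Y y' k' t'" "(h ^^ t) y = (h ^^ t') y'"
  shows "t' \<le> t"
proof (rule ccontr)
  assume "\<not> t' \<le> t"
  then have "(h ^^ t) y = (h ^^ t) ((h ^^ (t' - t)) y')"
    using assms(3) funpow_add[of t "t' - t" h] by simp
  then have "y = (h ^^ (t' - t)) y'"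
    using bij_fn[OF bij] by (simp add: bij_def inj_eq)
  then show False
    using assms(1,2) \<open>\<not> t' \<le> t\<close> unfolding paired_def by (auto simp: le_max_iff_disj)
qed

lemma paired_unique:
  assumes "paired A B Y y k t" "paired A B Y y' k' t'" "(h ^^ t) y = (h ^^ t') y'"
  shows "t = t' \<and> k = k'"
proof -
  have "t = t'"
    using paired_height_le[OF assms] paired_height_le[OF assms(2,1)] assms(3) by simp
  then have "y = y'"
    using assms(3) bij_fn[OF bij] by (simp add: bij_def inj_eq)
  then have "k = k'"
    using assms(1,2) \<open>t = t'\<close> unfolding paired_def by (intro visits_inj[of k h y A k']) auto
  then show ?thesis using \<open>t = t'\<close> by simp
qed

lemma packing_matched: "packing (matched A B Y R) B"
  unfolding packing_def
proof (intro conjI allI)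
  have "{d. matched A B Y R d \<noteq> {}} \<subseteq> {- int R..int R}"
    unfolding matched_def by auto
  then show "finite {d. matched A B Y R d \<noteq> {}}" using finite_subset by blast
  show "T d ` matched A B Y R d \<subseteq> B" for d
    by (auto simp: paired_def elim!: matchedE)
  have "d = e" if "x \<in> matched A B Y R d" "x' \<in> matched A B Y R e" "T d x = T e x'" for d e x x'
    using that paired_unique by (metis matchedE)
  then show "disjoint_family (\<lambda>d. T d ` matched A B Y R d)"
    unfolding disjoint_family_on_def by blast
qed

lemma paired_cong:
  assumes "\<And>j S. j \<le> max k t \<Longrightarrow> S \<in> {A, B, Y} \<Longrightarrow> (h ^^ j) y \<in> S \<longleftrightarrow> (h ^^ j) z \<in> S"
  shows "paired A B Y y k t \<longleftrightarrow> paired A B Y z k t"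
proof -
  have "visits h B t y = visits h B t z" "visits h A k y = visits h A k z"
    using assms by (auto intro!: visits_cong)
  then show ?thesis
    using assms[of 0 Y] assms[of k A] assms[of t B] assms[of _ Y] unfolding paired_def by auto
qed

lemma frontier_matched_subset:
  "frontier (matched A B Y R d) \<subseteq> (\<Union>i\<in>{- int R..int R}. \<Union>S\<in>{A, B, Y}. T i -` frontier S)"
proof (rule frontier_subset_of_local)
  fix x z
  assume same: "\<And>i S. i \<in> {- int R..int R} \<Longrightarrow> S \<in> {A, B, Y} \<Longrightarrow> T i x \<in> S \<longleftrightarrow> T i z \<in> S"
    and "x \<in> matched A B Y R d"
  then obtain k t where kt: "k \<le> R" "t \<le> R" "d = int t - int k" "paired A B Y (T (- int k) x) k t"
    unfolding matched_def by blast
  have "paired A B Y (T (- int k) x) k t \<longleftrightarrow> paired A B Y (T (- int k) z) k t"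
  proof (rule paired_cong)
    show "(h ^^ j) (T (- int k) x) \<in> S \<longleftrightarrow> (h ^^ j) (T (- int k) z) \<in> S"
      if "j \<le> max k t" "S \<in> {A, B, Y}" for j S
      using same[of "int j - int k" S] that kt(1,2) by (simp add: T_T flip: T_of_nat)
  qed
  then show "z \<in> matched A B Y R d" using kt unfolding matched_def by blast
qed (simp_all add: continuous_T)

lemma last_visit:
  assumes "\<And>x. \<exists>i\<le>R. (h ^^ i) x \<in> Y"
  obtains y k where "k \<le> R" "x = (h ^^ k) y" "y \<in> Y" "\<And>j. 0 < j \<Longrightarrow> j \<le> k \<Longrightarrow> (h ^^ j) y \<notin> Y"
proof -
  define k where "k = (LEAST k. T (- int k) x \<in> Y)"
  obtain i where i: "i \<le> R" "(h ^^ i) (T (- int R) x) \<in> Y" using assms by blast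
  then have "T (- int (R - i)) x \<in> Y" by (simp add: T_T of_nat_diff flip: T_of_nat)
  then have k: "T (- int k) x \<in> Y" "k \<le> R - i"
    unfolding k_def by (auto intro: LeastI Least_le)
  have "(h ^^ j) (T (- int k) x) \<notin> Y" if "0 < j" "j \<le> k" for j
  proof -
    have "T (- int (k - j)) x \<notin> Y"
      unfolding k_def by (rule not_less_Least) (use that in \<open>auto simp: k_def\<close>)
    then show ?thesis using that by (simp add: T_T of_nat_diff flip: T_of_nat)
  qed
  then show ?thesis
    using that[of k "T (- int k) x"] k by (simp add: T_T flip: T_of_nat)
qed

lemma first_return:
  assumes "\<And>x. \<exists>i\<le>R. (h ^^ i) x \<in> Y"
  obtains n where "0 < n" "n \<le> Suc R" "(h ^^ n) y \<in> Y" "\<And>j. 0 < j \<Longrightarrow> j < n \<Longrightarrow> (h ^^ j) y \<notin> Y"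
proof -
  let ?return = "\<lambda>n. 0 < n \<and> (h ^^ n) y \<in> Y"
  obtain i where i: "i \<le> R" "(h ^^ i) (h y) \<in> Y" using assms by blast
  then have "?return (Suc i)" by (simp add: funpow_swap1)
  then have "?return (Least ?return)" "Least ?return \<le> Suc i" by (rule LeastI, rule Least_le)
  moreover have "(h ^^ j) y \<notin> Y" if "0 < j" "j < Least ?return" for j
    using not_less_Least[OF that(2)] that(1) by simp
  ultimately show ?thesis using that[of "Least ?return"] i(1) by simp
qed

lemma subset_UN_matched:
  assumes hits: "\<And>x. \<exists>i\<le>R. (h ^^ i) x \<in> Y"
    and long_return: "\<And>y i. y \<in> Y \<Longrightarrow> 0 < i \<Longrightarrow> i < N \<Longrightarrow> (h ^^ i) y \<notin> Y"
    and visits_le: "\<And>n x. N \<le> n \<Longrightarrow> visits h A n x \<le> visits h B n x"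
  shows "A \<subseteq> (\<Union>d. matched A B Y R d)"
proof
  fix x assume "x \<in> A"
  obtain y k where k: "k \<le> R" "x = (h ^^ k) y" "y \<in> Y" "\<And>j. 0 < j \<Longrightarrow> j \<le> k \<Longrightarrow> (h ^^ j) y \<notin> Y"
    using last_visit[OF hits, of x] by metis
  obtain n where n: "0 < n" "n \<le> Suc R" "(h ^^ n) y \<in> Y" "\<And>j. 0 < j \<Longrightarrow> j < n \<Longrightarrow> (h ^^ j) y \<notin> Y"
    using first_return[OF hits, of y] by metis
  have "N \<le> n" using long_return[OF k(3) n(1)] n(3) by (meson not_less)
  have "k < n" using k(4)[OF n(1)] n(3) by (meson not_less)
  then have "visits h A k y < visits h A n y"
    using \<open>x \<in> A\<close> k(2) by (intro visits_less_length) auto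
  also have "\<dots> \<le> visits h B n y" using \<open>N \<le> n\<close> by (rule visits_le)
  finally obtain t where t: "t < n" "(h ^^ t) y \<in> B" "visits h B t y = visits h A k y"
    by (rule visits_attained)
  have "paired A B Y y k t"
    using k(2,3) n(4) t \<open>k < n\<close> \<open>x \<in> A\<close> by (auto simp: paired_def)
  moreover have "t \<le> R" using t(1) n(2) by simp
  moreover have "T (- int k) x = y" by (simp add: k(2) flip: T_of_nat)
  ultimately have "x \<in> matched A B Y R (int t - int k)"
    using k(1) unfolding matched_def by blast
  then show "x \<in> (\<Union>d. matched A B Y R d)" by blast
qed

end

context compact_homeo
begin

lemma subequiv_of_no_short_returns:
  assumes "closed F" "open V"
    and hits: "\<And>x. \<exists>i\<le>R. (h ^^ i) x \<in> V"
    and no_return: "\<And>x e. x \<in> F \<Longrightarrow> e \<in> {- int R..int R} - {0} \<Longrightarrow> T e x \<notin> F"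
  shows "subequiv F V"
proof -
  have "F \<subseteq> (\<Union>i\<in>{0..int R}. T i -` V)"
  proof
    fix x
    obtain i where "i \<le> R" "(h ^^ i) x \<in> V" using hits by blast
    then show "x \<in> (\<Union>i\<in>{0..int R}. T i -` V)"
      by (intro UN_I[of "int i"]) (simp_all add: T_of_nat)
  qed
  then obtain J L where L: "finite J" "J \<subseteq> {0..int R}" "\<And>i. compact (L i)" "\<And>i. L i \<subseteq> T i -` V"
    "\<And>i. i \<notin> J \<Longrightarrow> L i = {}" "F = (\<Union>i\<in>J. L i)"
    using compact_cover_by_compact_subsets[of F "{0..int R}" "\<lambda>i. T i -` V"]
      closed_imp_compact[OF assms(1)] open_T_vimage[OF assms(2)] by metis
  have "i = j" if "x \<in> L i" "y \<in> L j" "T i x = T j y" for i j x y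
  proof (rule ccontr)
    assume "i \<noteq> j"
    have ij: "i \<in> J" "j \<in> J" using L(5) that(1,2) by blast+
    have "T (i - j) x = T (- j) (T i x)" by (simp add: T_T)
    also have "\<dots> = y" using that(3) by simp
    finally have "T (i - j) x \<in> F" "x \<in> F" using that(1,2) ij L(6) by blast+
    moreover have "i \<in> {0..int R}" "j \<in> {0..int R}" using ij L(2) by blast+
    ultimately show False using no_return[of x "i - j"] \<open>i \<noteq> j\<close> by simp
  qed
  then have "disjoint_family (\<lambda>i. T i ` L i)" unfolding disjoint_family_on_def by blast
  moreover have "finite {i. L i \<noteq> {}}" using L(1,5) by (metis (mono_tags) finite_subset mem_Collect_eq subsetI)
  ultimately have "packing L V" using L(4) by (auto simp: packing_def)
  then show ?thesis
    unfolding subequiv_def using L(3,6) compact_imp_closed by (intro exI[of _ L]) auto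
qed

end

subsection \<open>Minimal systems\<close>

locale minimal_system = compact_homeo h for h :: "'a::metric_space \<Rightarrow> 'a" +
  assumes infinite_UNIV: "infinite (UNIV :: 'a set)"
    and minimal: "minimal_hom h"
begin

lemma orbit_hits_open:
  assumes "open V" "V \<noteq> {}"
  obtains R where "\<And>x. \<exists>i\<le>R. (h ^^ i) x \<in> V"
proof -
  define Z where "Z = - (\<Union>i. T i -` V)"
  have "h -` Z = Z"
  proof -
    have "(\<exists>i. T i (h x) \<in> V) \<longleftrightarrow> (\<exists>i. T i x \<in> V)" for x
      using T_add[of _ 1 x] by (metis T_1 diff_add_cancel)
    then show ?thesis unfolding Z_def by auto
  qed
  then have "h ` Z = Z" using bij by (metis bij_is_surj surj_image_vimage_eq)
  moreover have "closed Z"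
    unfolding Z_def by (intro closed_Compl open_UN ballI open_T_vimage assms(1))
  moreover have "Z \<noteq> UNIV" using assms(2) T_0 unfolding Z_def by blast
  ultimately have "Z = {}" using minimal unfolding minimal_hom_def by blast
  then have "UNIV \<subseteq> (\<Union>i. T i -` V)" unfolding Z_def by blast
  then obtain I where I: "finite I" "UNIV \<subseteq> (\<Union>i\<in>I. T i -` V)"
    using compactE_image[OF compact_UNIV, of UNIV "\<lambda>i. T i -` V"] open_T_vimage[OF assms(1)] by metis
  obtain M where M: "\<And>i. i \<in> I \<Longrightarrow> \<bar>i\<bar> \<le> M"
    using I(1) unfolding finite_int_iff_bounded_le by blast
  have "\<exists>i\<le>nat (2 * M). (h ^^ i) x \<in> V" for x
  proof -
    obtain i where i: "i \<in> I" "T i (T M x) \<in> V" using I(2) by blast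
    have "\<bar>i\<bar> \<le> M" using M i by blast
    then have "nat (i + M) \<le> nat (2 * M)" "int (nat (i + M)) = i + M" by auto
    then show ?thesis using i(2) by (metis T_T T_of_nat)
  qed
  then show ?thesis by (rule that)
qed

lemma aperiodic:
  assumes "0 < n"
  shows "(h ^^ n) x \<noteq> x"
proof
  assume periodic: "(h ^^ n) x = x"
  have "range (\<lambda>i. (h ^^ i) x) \<subseteq> (\<lambda>i. (h ^^ i) x) ` {..<n}"
  proof (rule image_subsetI)
    show "(h ^^ i) x \<in> (\<lambda>i. (h ^^ i) x) ` {..<n}" for i
      by (rule image_eqI[of _ _ "i mod n"]) (use assms funpow_mod_eq[OF periodic] in auto)
  qed
  then have finite: "finite (range (\<lambda>i. (h ^^ i) x))" by (rule finite_subset) simp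
  have "h ` range (\<lambda>i. (h ^^ i) x) = range (\<lambda>i. (h ^^ i) x)"
  proof (rule endo_inj_surj[OF finite])
    show "h ` range (\<lambda>i. (h ^^ i) x) \<subseteq> range (\<lambda>i. (h ^^ i) x)"
      by (auto intro: range_eqI[of _ _ "Suc _"])
    show "inj_on h (range (\<lambda>i. (h ^^ i) x))"
      using bij by (auto simp: bij_def intro: inj_on_subset)
  qed
  then have "range (\<lambda>i. (h ^^ i) x) = UNIV"
    using minimal finite_imp_closed[OF finite] unfolding minimal_hom_def by blast
  then show False using finite infinite_UNIV by simp
qed

lemma inj_orbit: "inj (\<lambda>n. (h ^^ n) x)"
proof (rule linorder_injI)
  fix m n :: nat assume "m < n"
  then have "(h ^^ (n - m)) ((h ^^ m) x) = (h ^^ n) x"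
    using funpow_add[of "n - m" m h] by simp
  then show "(h ^^ m) x \<noteq> (h ^^ n) x"
    using aperiodic[of "n - m" "(h ^^ m) x"] \<open>m < n\<close> by auto
qed

lemma split_open:
  assumes "open (V :: 'a set)" "V \<noteq> {}"
  obtains V0 V1 where "open V0" "open V1" "V0 \<noteq> {}" "V1 \<noteq> {}" "V0 \<inter> V1 = {}"
    "V0 \<union> V1 \<subseteq> V"
proof -
  obtain x where "x \<in> V" using assms(2) by blast
  obtain i where i: "(h ^^ i) (h x) \<in> V" using orbit_hits_open[OF assms] by metis
  define y where "y = (h ^^ Suc i) x"
  have "y \<in> V" "y \<noteq> x"
    using i aperiodic[of "Suc i" x] by (simp_all add: y_def funpow_swap1)
  then obtain A B where "open A" "open B" "x \<in> A" "y \<in> B" "A \<inter> B = {}"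
    by (metis hausdorff)
  then show ?thesis
    using that[of "A \<inter> V" "B \<inter> V"] \<open>x \<in> V\<close> \<open>y \<in> V\<close> assms(1) by blast
qed

lemma thin_Un:
  assumes "thin F" "thin G"
  shows "thin (F \<union> G)"
  unfolding thin_def
proof (intro allI impI)
  fix V :: "'a set" assume "open V" "V \<noteq> {}"
  then obtain V0 V1 where V: "open V0" "open V1" "V0 \<noteq> {}" "V1 \<noteq> {}" "V0 \<inter> V1 = {}"
    "V0 \<union> V1 \<subseteq> V"
    by (rule split_open)
  have "subequiv (F \<union> G) (V0 \<union> V1)"
    using assms V unfolding thin_def by (intro subequiv_Un) auto
  then show "subequiv (F \<union> G) V" using V(6) by (rule subequiv_mono[OF _ order_refl])
qed

lemma thin_UN:
  assumes "finite I" "\<And>i. i \<in> I \<Longrightarrow> thin (F i)"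
  shows "thin (\<Union>i\<in>I. F i)"
  using assms
proof (induction I rule: finite_induct)
  case empty
  show ?case by (simp add: thin_def subequiv_empty)
next
  case (insert i I)
  then show ?case by (simp add: thin_Un)
qed

text \<open>Points of \<open>F\<close> returning to \<open>F\<close> within the hitting time of half of \<open>V\<close> lie in sets
  \<open>F \<inter> h\<^sup>-\<^sup>e F\<close> with a smaller constant, which the other half absorbs.\<close>

lemma small_imp_thin:
  assumes "closed F" "small m F"
  shows "thin F"
  using assms
proof (induction m arbitrary: F)
  case 0
  then show ?case by (simp add: small_0_iff thin_def subequiv_empty)
next
  case (Suc m)
  show ?case unfolding thin_def
  proof (intro allI impI)
    fix V :: "'a set" assume "open V" "V \<noteq> {}"
    then obtain V0 V1 where V: "open V0" "open V1" "V0 \<noteq> {}" "V1 \<noteq> {}" "V0 \<inter> V1 = {}"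
      "V0 \<union> V1 \<subseteq> V"
      by (rule split_open)
    obtain R where hits: "\<And>x. \<exists>i\<le>R. (h ^^ i) x \<in> V1" using orbit_hits_open[OF V(2,4)] by blast
    define E where "E = {- int R..int R} - {0}"
    have "thin (\<Union>e\<in>E. F \<inter> T e -` F)"
    proof (rule thin_UN)
      show "thin (F \<inter> T e -` F)" if "e \<in> E" for e
        using that Suc.prems
        by (intro Suc.IH closed_Int closed_T_vimage small_Int_T_vimage) (auto simp: E_def)
    qed (simp add: E_def)
    then have "subequiv F (V0 \<union> V1)"
    proof (rule subequiv_modulo_thin[OF _ V(1,3,5)])
      fix Q assume Q: "open Q" "(\<Union>e\<in>E. F \<inter> T e -` F) \<subseteq> Q"
      show "subequiv (F - Q) V1"
      proof (rule subequiv_of_no_short_returns[OF _ V(2) hits])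
        show "closed (F - Q)" using Suc.prems(1) Q(1) by (rule closed_Diff)
        show "T e x \<notin> F - Q" if "x \<in> F - Q" "e \<in> {- int R..int R} - {0}" for e x
          using that Q(2) unfolding E_def by blast
      qed
    qed
    then show "subequiv F V" using V(6) by (rule subequiv_mono[OF _ order_refl])
  qed
qed

subsection \<open>Comparison\<close>

lemma subequiv_of_visits_le:
  assumes "small a (frontier A)" "small b (frontier B)" "small c (frontier Y)"
    and hits: "\<And>x. \<exists>i\<le>R. (h ^^ i) x \<in> Y"
    and long_return: "\<And>y i. y \<in> Y \<Longrightarrow> 0 < i \<Longrightarrow> i < N \<Longrightarrow> (h ^^ i) y \<notin> Y"
    and visits_le: "\<And>n x. N \<le> n \<Longrightarrow> visits h A n x \<le> visits h B n x"
    and V: "open V" "V \<noteq> {}" "V \<inter> B = {}"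
  shows "subequiv A (V \<union> B)"
proof (rule subequiv_modulo_thin[OF _ V])
  let ?F = "\<Union>i\<in>{- int R..int R}. \<Union>S\<in>{A, B, Y}. T i -` frontier S"
  have "closed ?F" by (intro closed_UN ballI closed_T_vimage) auto
  moreover have "\<exists>m. small m ?F"
    by (intro small_UN) (use assms(1-3) small_T_vimage in blast)+
  ultimately show "thin ?F" using small_imp_thin by blast
  show "subequiv (A - Q) B" if "open Q" "?F \<subseteq> Q" for Q
  proof (rule subequiv_mono)
    show "subequiv ((\<Union>d. matched A B Y R d) - Q) B"
      by (rule subequiv_packing_Diff[OF packing_matched that(1)
            order_trans[OF frontier_matched_subset that(2)]])
    show "A - Q \<subseteq> (\<Union>d. matched A B Y R d) - Q"
      using subset_UN_matched[OF hits long_return visits_le] by blast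
  qed simp
qed

lemma small_frontier_neighbourhood:
  assumes "top_small_boundary_property h" "closed F" "open G" "F \<subseteq> G"
  obtains A m where "open A" "F \<subseteq> A" "closure A \<subseteq> G" "small m (frontier A)"
proof -
  have "compact F \<and> compact (- G) \<and> F \<inter> - G = {}"
    using assms by (auto intro!: closed_imp_compact)
  then obtain A V where AV: "open A" "F \<subseteq> A" "- G \<subseteq> V" "closure A \<inter> closure V = {}"
    "top_small h (frontier A)"
    using assms(1)[unfolded top_small_boundary_property_def, rule_format, of F "- G"] by blast
  have "closure A \<subseteq> G" using AV(3,4) closure_subset[of V] by blast
  moreover obtain m where "small m (frontier A)" using top_small_imp_small[OF AV(5)] .
  ultimately show ?thesis using that AV(1,2) by blast
qed

lemma long_return_neighbourhood:
  fixes N :: nat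
  obtains G where "open G" "u \<in> G" "\<And>y i. y \<in> G \<Longrightarrow> 0 < i \<Longrightarrow> i < N \<Longrightarrow> (h ^^ i) y \<notin> G"
proof -
  have "\<exists>P Q. open P \<and> open Q \<and> u \<in> P \<and> (h ^^ i) u \<in> Q \<and> P \<inter> Q = {}" if "0 < i" for i
    using hausdorff[OF aperiodic[OF that, symmetric]] .
  then obtain P Q where PQ: "\<And>i. 0 < i \<Longrightarrow> open (P i)" "\<And>i. 0 < i \<Longrightarrow> open (Q i)"
    "\<And>i. 0 < i \<Longrightarrow> u \<in> P i" "\<And>i. 0 < i \<Longrightarrow> (h ^^ i) u \<in> Q i" "\<And>i. 0 < i \<Longrightarrow> P i \<inter> Q i = {}"
    by metis
  define G where "G = (\<Inter>i\<in>{0<..<N}. P i \<inter> T (int i) -` Q i)"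
  show ?thesis
  proof (rule that[of G])
    show "open G"
      unfolding G_def using PQ(1,2) by (intro open_INT ballI open_Int open_T_vimage) auto
    show "u \<in> G" using PQ(3,4) by (simp add: G_def T_of_nat)
    fix y i assume "y \<in> G" "0 < i" "i < N"
    then have "(h ^^ i) y \<in> Q i" by (simp add: G_def T_of_nat)
    then have "(h ^^ i) y \<notin> P i" using PQ(5)[OF \<open>0 < i\<close>] by blast
    then show "(h ^^ i) y \<notin> G" using \<open>0 < i\<close> \<open>i < N\<close> by (auto simp: G_def)
  qed
qed

lemma small_frontier_long_return_set:
  fixes N :: nat
  assumes "top_small_boundary_property h"
  obtains Y m where "open Y" "Y \<noteq> {}" "small m (frontier Y)"
    "\<And>y i. y \<in> Y \<Longrightarrow> 0 < i \<Longrightarrow> i < N \<Longrightarrow> (h ^^ i) y \<notin> Y"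
proof -
  obtain u G where G: "open G" "u \<in> G" "\<And>y i. y \<in> G \<Longrightarrow> 0 < i \<Longrightarrow> i < N \<Longrightarrow> (h ^^ i) y \<notin> G"
    using long_return_neighbourhood by metis
  obtain Y m where Y: "open Y" "{u} \<subseteq> Y" "closure Y \<subseteq> G" "small m (frontier Y)"
    using small_frontier_neighbourhood[OF assms, of "{u}" G] G(1,2) by auto
  have "Y \<subseteq> G" using Y(3) closure_subset by blast
  then show ?thesis using that[of Y m] Y(1,2,4) G(3) by blast
qed

lemma emeasure_Diff_singleton:
  assumes "\<mu> \<in> inv_measures h" "U \<in> sets borel"
  shows "emeasure \<mu> (U - {u}) = emeasure \<mu> U"
proof -
  have "sets \<mu> = sets borel" using assms(1) by (simp add: inv_measures_def)
  then show ?thesis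
    using emeasure_singleton_eq_0[OF inj_orbit assms(1)] assms(2)
    by (intro emeasure_Diff_null_set) (auto simp: null_sets_def)
qed

lemma nonempty_of_emeasure_less:
  assumes "closed C" "open U" "\<forall>\<mu>\<in>inv_measures h. emeasure \<mu> C < emeasure \<mu> U"
  shows "U \<noteq> {}"
proof
  assume "U = {}"
  from ex_neighbourhoods_fewer_visits[OF assms] obtain W K where
    "K \<subseteq> U" "eventually_fewer_visits h W K"
    by (elim exE conjE) (rule that)
  then have "eventually_fewer_visits h W {}" using \<open>U = {}\<close> by simp
  then show False unfolding eventually_fewer_visits_def by auto
qed

text \<open>Invariant measures do not charge points, so a neighbourhood of a point \<open>u\<close> of \<open>U\<close> can be set aside
  for the boundaries of the pieces.\<close>

lemma subequiv_of_emeasure_less: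
  assumes sbp: "top_small_boundary_property h" and C: "closed C" and U: "open U"
    and less: "\<forall>\<mu>\<in>inv_measures h. emeasure \<mu> C < emeasure \<mu> U"
  shows "subequiv C U"
proof -
  obtain u where u: "u \<in> U" using nonempty_of_emeasure_less[OF C U less] by blast
  have U_u: "open (U - {u})" using U by (simp add: open_Diff)
  have "\<forall>\<mu>\<in>inv_measures h. emeasure \<mu> C < emeasure \<mu> (U - {u})"
    using less emeasure_Diff_singleton U by simp
  from ex_neighbourhoods_fewer_visits[OF C U_u this] obtain W K where
    WK: "open W" "C \<subseteq> W" "closed K" "K \<subseteq> U - {u}" and "eventually_fewer_visits h W K"
    by (elim exE conjE) (rule that)
  then obtain N where visits_less: "\<forall>n\<ge>N. \<forall>x. visits h W n x < visits h K n x"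
    unfolding eventually_fewer_visits_def by blast
  obtain A a where A: "open A" "C \<subseteq> A" "closure A \<subseteq> W" "small a (frontier A)"
    using small_frontier_neighbourhood[OF sbp C WK(1,2)] .
  obtain B b where B: "open B" "K \<subseteq> B" "closure B \<subseteq> U - {u}" "small b (frontier B)"
    using small_frontier_neighbourhood[OF sbp WK(3) U_u WK(4)] .
  have AB: "visits h A n x \<le> visits h B n x" if "N \<le> n" for n x
  proof -
    have "visits h A n x \<le> visits h W n x"
      using A(3) closure_subset by (intro visits_mono) blast
    also have "\<dots> < visits h K n x" using that visits_less by blast
    also have "\<dots> \<le> visits h B n x" using B(2) by (rule visits_mono)
    finally show ?thesis by simp
  qed
  obtain Y c where Y: "open Y" "Y \<noteq> {}" "small c (frontier Y)"
    "\<And>y i. y \<in> Y \<Longrightarrow> 0 < i \<Longrightarrow> i < N \<Longrightarrow> (h ^^ i) y \<notin> Y"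
    using small_frontier_long_return_set[OF sbp] by metis
  obtain R where hits: "\<And>x. \<exists>i\<le>R. (h ^^ i) x \<in> Y" using orbit_hits_open[OF Y(1,2)] by blast
  have "subequiv A ((U - closure B) \<union> B)"
  proof (rule subequiv_of_visits_le[OF A(4) B(4) Y(3) hits Y(4) AB])
    show "open (U - closure B)" using U by (intro open_Diff) auto
    show "U - closure B \<noteq> {}" using u B(3) by blast
    show "(U - closure B) \<inter> B = {}" using closure_subset[of B] by blast
  qed
  then show ?thesis
    by (rule subequiv_mono) (use A(2) B(3) closure_subset[of B] in blast)+
qed

end

theorem theorem5p6:
  fixes h :: "'a::metric_space \<Rightarrow> 'a"
  assumes "compact (UNIV :: 'a set)"
    and "infinite (UNIV :: 'a set)"
    and "\<exists>g. homeomorphism UNIV UNIV h g"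
    and "minimal_hom h"
    and "top_small_boundary_property h"
  shows "dynamic_comparison_property h"
proof -
  obtain g where g: "homeomorphism UNIV UNIV h g" using assms(3) by blast
  then have inv_eq: "inv h = g" unfolding homeomorphism_def by (intro inv_equality) auto
  interpret minimal_system h by unfold_locales (use g inv_eq assms in auto)
  have "subequiv C U"
    if "closed C" "open U" "\<forall>\<mu>\<in>inv_measures h. emeasure \<mu> C < emeasure \<mu> U" for C U
    using assms(5) that by (rule subequiv_of_emeasure_less)
  then show ?thesis
    unfolding dynamic_comparison_property_def
    by (intro allI impI subequiv_imp_comparison_functions) auto
qed

end
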